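(* Let $\phi=(M,c)$ be a qubit channel (completely positive, trace-preserving) in Bloch representation. Then $\phi$ is entanglement-saving if and only if one of the following holds. (1) There exist $O\in SO(3)$, $\theta\in\mathbb R$, $0<\lambda\le 1$, $\lambda^2\le\mu\le 1$ and $\alpha\ge 0$ with $\alpha^2\le(1-\mu)(\mu-\lambda^2)$ such that $$M=O\begin{pmatrix}\lambda\cos\theta&\lambda\sin\theta&\alpha\\-\lambda\sin\theta&\lambda\cos\theta&0\\0&0&\mu\end{pmatrix}O^T,\qquad c=O\begin{pmatrix}-\alpha\\0\\1-\mu\end{pmatrix}.$$ (2) $c=0$ and there exist $O\in SO(3)$, $\theta\in\mathbb R$, $0<\lambda\le 1$ such that $$M=O\begin{pmatrix}\lambda\cos\theta&\lambda\sin\theta&0\\ \lambda\sin\theta&-\lambda\cos\theta&0\\0&0&-1\end{pmatrix}O^T .$$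
   Context: Bloch representation: a qubit state is $\frac{\mathbb 1+\vec r\cdot\vec\sigma}{2}$ with $\vec r\in\mathbb R^3$, $|\vec r|\le1$, $\vec\sigma=(X,Y,Z)$ the Pauli matrices; a trace-preserving qubit map is denoted $(M,c)$, $M\in\mathcal M(3;\mathbb R)$, $c\in\mathbb R^3$, if it sends $\frac{\mathbb 1+\vec r\cdot\vec\sigma}{2}\mapsto\frac{\mathbb 1+(M\vec r+c)\cdot\vec\sigma}{2}$. A channel is entanglement-breaking if $(\phi\otimes I)(\rho)$ is separable for every bipartite state $\rho$; it is entanglement-saving if $\phi^n$ is not entanglement-breaking for all integers $n\ge1$. *)

theory Defs
  imports "Jordan_Normal_Form.Determinant"
begin

definition mtrace :: "complex mat \<Rightarrow> complex" where
  "mtrace A = (\<Sum>i<dim_row A. A $$ (i,i))"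

text \<open>Positive semidefinite n x n complex matrix (for complex matrices this also forces Hermiticity).\<close>
definition psd :: "nat \<Rightarrow> complex mat \<Rightarrow> bool" where
  "psd n A \<longleftrightarrow> A \<in> carrier_mat n n \<and>
     (\<forall>v :: nat \<Rightarrow> complex. (\<Sum>i<n. \<Sum>j<n. cnj (v i) * A $$ (i,j) * v j) \<in> \<real> \<and>
                              0 \<le> Re (\<Sum>i<n. \<Sum>j<n. cnj (v i) * A $$ (i,j) * v j))"

definition density :: "nat \<Rightarrow> complex mat \<Rightarrow> bool" where
  "density n A \<longleftrightarrow> psd n A \<and> mtrace A = 1"

definition pauli :: "nat \<Rightarrow> complex mat" where
  "pauli k = (if k = 0 then mat_of_rows_list 2 [[0,1],[1,0]]
              else if k = 1 then mat_of_rows_list 2 [[0,-\<i>],[\<i>,0]]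
              else mat_of_rows_list 2 [[1,0],[0,-1]])"

text \<open>The (linear extension of the) trace-preserving qubit map (M,c) in Bloch representation:
  A = (tr A 1 + sum r_i sigma_i)/2 with r_i = tr(A sigma_i) is sent to
  (tr A 1 + sum_i (sum_j M_ij r_j + c_i tr A) sigma_i)/2.
  On states (1 + r.sigma)/2 this is (1 + (M r + c).sigma)/2.\<close>
definition bloch_map :: "real mat \<Rightarrow> real vec \<Rightarrow> complex mat \<Rightarrow> complex mat" where
  "bloch_map M c A = mat 2 2 (\<lambda>(a,b).
      (1/2) * (mtrace A * (if a = b then 1 else 0) +
        (\<Sum>i<3. ((\<Sum>j<3. complex_of_real (M $$ (i,j)) * mtrace (A * pauli j))
                 + complex_of_real (c $ i) * mtrace A) * pauli i $$ (a,b))))"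

definition unit2 :: "nat \<Rightarrow> nat \<Rightarrow> complex mat" where
  "unit2 a b = mat 2 2 (\<lambda>(i,j). if i = a \<and> j = b then 1 else 0)"

text \<open>(f \<otimes> id_n) applied to a matrix on C^2 \<otimes> C^n, where the basis vector e_a \<otimes> e_i
  has index a*n + i.\<close>
definition ext_id :: "(complex mat \<Rightarrow> complex mat) \<Rightarrow> nat \<Rightarrow> complex mat \<Rightarrow> complex mat" where
  "ext_id f n \<rho> = mat (2*n) (2*n) (\<lambda>(r,s).
      \<Sum>a<2. \<Sum>b<2. f (unit2 a b) $$ (r div n, s div n) * \<rho> $$ (a*n + r mod n, b*n + s mod n))"

definition kron2 :: "nat \<Rightarrow> complex mat \<Rightarrow> complex mat \<Rightarrow> complex mat" where
  "kron2 n \<sigma> \<tau> = mat (2*n) (2*n) (\<lambda>(r,s). \<sigma> $$ (r div n, s div n) * \<tau> $$ (r mod n, s mod n))"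

definition separable :: "nat \<Rightarrow> complex mat \<Rightarrow> bool" where
  "separable n \<rho> \<longleftrightarrow> (\<exists>(m::nat) (p::nat \<Rightarrow> real) \<sigma> \<tau>.
      (\<forall>k<m. 0 \<le> p k \<and> density 2 (\<sigma> k) \<and> density n (\<tau> k)) \<and> (\<Sum>k<m. p k) = 1 \<and>
      \<rho> = mat (2*n) (2*n) (\<lambda>(r,s). \<Sum>k<m. complex_of_real (p k) * kron2 n (\<sigma> k) (\<tau> k) $$ (r,s)))"

definition completely_positive :: "(complex mat \<Rightarrow> complex mat) \<Rightarrow> bool" where
  "completely_positive f \<longleftrightarrow> (\<forall>n \<ge> 1. \<forall>\<rho>. psd (2*n) \<rho> \<longrightarrow> psd (2*n) (ext_id f n \<rho>))"

text \<open>A qubit map (M,c) is a channel iff it is completely positive (it is trace preserving by construction).\<close>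
definition qubit_channel :: "real mat \<Rightarrow> real vec \<Rightarrow> bool" where
  "qubit_channel M c \<longleftrightarrow> M \<in> carrier_mat 3 3 \<and> c \<in> carrier_vec 3 \<and> completely_positive (bloch_map M c)"

definition entanglement_breaking :: "(complex mat \<Rightarrow> complex mat) \<Rightarrow> bool" where
  "entanglement_breaking f \<longleftrightarrow>
     (\<forall>n \<ge> 1. \<forall>\<rho>. density (2*n) \<rho> \<longrightarrow> separable n (ext_id f n \<rho>))"

definition entanglement_saving :: "(complex mat \<Rightarrow> complex mat) \<Rightarrow> bool" where
  "entanglement_saving f \<longleftrightarrow> (\<forall>k \<ge> 1. \<not> entanglement_breaking (f ^^ k))"

definition SO3 :: "real mat set" where
  "SO3 = {Q. Q \<in> carrier_mat 3 3 \<and> Q * transpose_mat Q = 1\<^sub>m 3 \<and> det Q = 1}"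

end

theory Submission
  imports "HOL-Analysis.Analysis" Defs
begin

text \<open>Entanglement breaking maps are exactly the measure-and-prepare maps. In Bloch terms: if such a map
  sends a pure \<open>p\<close> to a pure \<open>q\<close>, all states prepared with an outcome that \<open>p\<close> can trigger equal \<open>q\<close>,
  so \<open>M\<close> kills the plane orthogonal to \<open>p\<close>. The normal forms have invertible \<open>M\<close> and a pure orbit, hence
  are entanglement-saving.

  Conversely, look at \<open>\<phi>\<^sup>3\<close> on the Bloch sphere. If it maps the sphere into the open ball, then by compactness
  and the parallelogram law \<open>\<parallel>M\<^sup>3\<parallel> < 1\<close>, so the powers of \<open>\<phi>\<close> tend to constant maps onto a mixed state and
  eventually become measure-and-prepare maps. Otherwise some pure state has a pure orbit of length four. Complete
  positivity makes \<open>M\<close> conformal from \<open>p\<close>'s orthogonal plane to that of \<open>q\<close> whenever \<open>p\<close> and its image \<open>q\<close>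
  are pure. Comparing distances along the orbit shows that three distinct orbit points force a rotation. So there
  is always a pure fixed state or a swapped pair of pure states, which leads to the two normal forms.\<close>

text \<open>The third power is used because the distance comparison needs three consecutive pure
  steps: the middle one supplies the conformal plane map, the outer two supply the two test points
  at which it is evaluated. The whole orbit is pure as soon as its last point is: a channel sending
  an interior point of the ball to the sphere is constant with a pure value, and that value is a
  pure fixed state. A rotation has one too, on its axis.

  The condition \<open>0 < lam\<close> in both forms records that \<phi> itself is not
  entanglement-breaking: if the plane orthogonal to the pure state were killed, \<phi> would merely
  measure along that state and prepare. The bound on \<alpha> is a Schur complement of the 3 by 3
  Choi block. The planar blocks of the two forms differ because conformality intertwines the quarter
  turn about \<open>p\<close> with the one about its image: an unchanged axis leaves a scaled
  rotation, a reversed axis a scaled reflection.\<close>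

no_notation vec_index (infixl "$" 100)
hide_type (open) Finite_Cartesian_Product.vec
hide_const (open) Determinants.det

subsection \<open>Matrices over \<open>{0,1,2}\<close> and over the index type \<open>3\<close>\<close>

definition index3 :: "nat \<Rightarrow> 3" where
  "index3 k = (if k = 0 then 1 else if k = 1 then 2 else 3)"

definition nat3 :: "3 \<Rightarrow> nat" where
  "nat3 i = (if i = 1 then 0 else if i = 2 then 1 else 2)"

lemma index3_simps [simp]: "index3 0 = 1" "index3 (Suc 0) = 2" "index3 2 = 3"
  by (simp_all add: index3_def)

lemma nat3_simps [simp]: "nat3 1 = 0" "nat3 2 = Suc 0" "nat3 3 = 2"
  by (simp_all add: nat3_def)

lemma nat3_less [simp]: "nat3 i < 3"
  by (simp add: nat3_def)

lemma nat3_index3 [simp]: "k < 3 \<Longrightarrow> nat3 (index3 k) = k"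
  by (auto simp: nat3_def index3_def)

lemma index3_nat3 [simp]: "index3 (nat3 i) = i"
  using exhaust_3[of i] by auto

lemma sum_less_3: "(\<Sum>k<3. f k) = f 0 + f (Suc 0) + (f 2 :: 'a::comm_monoid_add)"
  by (simp add: numeral_3_eq_3 numeral_2_eq_2)

lemma sum_less_2: "(\<Sum>k<2. f k) = f 0 + (f (Suc 0) :: 'a::comm_monoid_add)"
  by (simp add: numeral_2_eq_2)

text \<open>The statement uses matrices with dimensions in carrier sets, while norms, cross products
  and compactness live on \<open>real^3\<close>. The whole argument is carried out on the latter
  type; only the final theorem passes through this translation.\<close>

definition mat3 :: "real mat \<Rightarrow> real^3^3" where
  "mat3 A = (\<chi> i j. A $$ (nat3 i, nat3 j))"

definition vec3 :: "real vec \<Rightarrow> real^3" where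
  "vec3 v = (\<chi> i. vec_index v (nat3 i))"

definition of_mat3 :: "real^3^3 \<Rightarrow> real mat" where
  "of_mat3 A = Matrix.mat 3 3 (\<lambda>(i,j). A $ index3 i $ index3 j)"

definition of_vec3 :: "real^3 \<Rightarrow> real vec" where
  "of_vec3 v = Matrix.vec 3 (\<lambda>i. v $ index3 i)"

lemma of_mat3_carrier [simp]: "of_mat3 A \<in> carrier_mat 3 3"
  by (simp add: of_mat3_def)

lemma of_vec3_carrier [simp]: "of_vec3 v \<in> carrier_vec 3"
  by (simp add: of_vec3_def)

lemma mat3_of_mat3 [simp]: "mat3 (of_mat3 A) = A"
  by (simp add: mat3_def of_mat3_def Finite_Cartesian_Product.vec_eq_iff)

lemma vec3_of_vec3 [simp]: "vec3 (of_vec3 v) = v"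
  by (simp add: vec3_def of_vec3_def Finite_Cartesian_Product.vec_eq_iff)

lemma of_mat3_mat3 [simp]: "A \<in> carrier_mat 3 3 \<Longrightarrow> of_mat3 (mat3 A) = A"
  by (rule eq_matI) (auto simp: mat3_def of_mat3_def)

lemma of_vec3_vec3 [simp]: "v \<in> carrier_vec 3 \<Longrightarrow> of_vec3 (vec3 v) = v"
  by (rule eq_vecI) (auto simp: vec3_def of_vec3_def)

lemma mat3_eq_iff: "A \<in> carrier_mat 3 3 \<Longrightarrow> B \<in> carrier_mat 3 3 \<Longrightarrow> A = B \<longleftrightarrow> mat3 A = mat3 B"
  by (metis of_mat3_mat3)

lemma vec3_eq_iff: "v \<in> carrier_vec 3 \<Longrightarrow> w \<in> carrier_vec 3 \<Longrightarrow> v = w \<longleftrightarrow> vec3 v = vec3 w"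
  by (metis of_vec3_vec3)

lemma mat3_mult:
  assumes "A \<in> carrier_mat 3 3" "B \<in> carrier_mat 3 3"
  shows "mat3 (A * B) = mat3 A ** mat3 B"
proof -
  have "(A * B) $$ (nat3 i, nat3 j) = (\<Sum>k\<in>UNIV. A $$ (nat3 i, nat3 k) * B $$ (nat3 k, nat3 j))" for i j
    using assms nat3_less[of i] nat3_less[of j]
    by (auto simp: scalar_prod_def sum_3 atLeast0LessThan sum_less_3 simp del: nat3_less)
  then show ?thesis
    by (simp add: mat3_def matrix_matrix_mult_def Finite_Cartesian_Product.vec_eq_iff)
qed

lemma mat3_mult_vec:
  assumes "A \<in> carrier_mat 3 3" "v \<in> carrier_vec 3"
  shows "vec3 (A *\<^sub>v v) = mat3 A *v vec3 v"
proof -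
  have "vec_index (A *\<^sub>v v) (nat3 i) = (\<Sum>k\<in>UNIV. A $$ (nat3 i, nat3 k) * vec_index v (nat3 k))" for i
    using assms nat3_less[of i]
    by (auto simp: scalar_prod_def sum_3 atLeast0LessThan sum_less_3 simp del: nat3_less)
  then show ?thesis
    by (simp add: mat3_def vec3_def matrix_vector_mult_def Finite_Cartesian_Product.vec_eq_iff)
qed

lemma mat3_transpose: "A \<in> carrier_mat 3 3 \<Longrightarrow> mat3 (transpose_mat A) = transpose (mat3 A)"
  by (auto simp: mat3_def Finite_Cartesian_Product.transpose_def Finite_Cartesian_Product.vec_eq_iff)

lemma mat3_one: "mat3 (1\<^sub>m 3) = Finite_Cartesian_Product.mat 1"
  by (auto simp: mat3_def Finite_Cartesian_Product.mat_def Finite_Cartesian_Product.vec_eq_iff) (metis index3_nat3)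

lemma vec3_zero [simp]: "vec3 (0\<^sub>v 3) = 0"
  by (simp add: vec3_def Finite_Cartesian_Product.zero_vec_def)

lemma det_mat3:
  assumes "A \<in> carrier_mat 3 3"
  shows "Determinant.det A = Determinants.det (mat3 A)"
proof -
  have c2: "mat_delete A i 0 \<in> carrier_mat 2 2" if "i < 3" for i
    using assms that by (auto simp: mat_delete_def)
  have d2: "Determinant.det B = B $$ (0,0) * B $$ (1,1) - B $$ (0,1) * B $$ (1,0)"
    if "B \<in> carrier_mat 2 2" for B :: "real mat"
    using that laplace_expansion_column[OF that, of 0]
    by (simp add: sum_less_2 cofactor_def mat_delete_def det_single)
  show ?thesis
    using assms laplace_expansion_column[OF assms, of 0]
    apply (simp add: sum_less_3 cofactor_def d2[OF c2])
    apply (simp add: mat_delete_def det_3 mat3_def numeral_2_eq_2 algebra_simps)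
    done
qed

lemma SO3_iff:
  "Q \<in> SO3 \<longleftrightarrow> Q \<in> carrier_mat 3 3 \<and> mat3 Q ** transpose (mat3 Q) = Finite_Cartesian_Product.mat 1 \<and> Determinants.det (mat3 Q) = 1"
proof -
  have "Q * transpose_mat Q = 1\<^sub>m 3 \<longleftrightarrow> mat3 Q ** transpose (mat3 Q) = Finite_Cartesian_Product.mat 1"
    if "Q \<in> carrier_mat 3 3"
    using that mat3_eq_iff[of "Q * transpose_mat Q" "1\<^sub>m 3"]
    by (simp add: mat3_mult mat3_transpose mat3_one)
  then show ?thesis
    by (auto simp: SO3_def det_mat3)
qed

subsection \<open>Bloch maps\<close>

lemma pauli_dim [simp]: "dim_row (pauli k) = 2" "dim_col (pauli k) = 2"
  by (simp_all add: pauli_def mat_of_rows_list_def)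

lemma pauli_index [simp]:
  "pauli 0 $$ (0,0) = 0" "pauli 0 $$ (0,Suc 0) = 1" "pauli 0 $$ (Suc 0,0) = 1" "pauli 0 $$ (Suc 0,Suc 0) = 0"
  "pauli (Suc 0) $$ (0,0) = 0" "pauli (Suc 0) $$ (0,Suc 0) = -\<i>" "pauli (Suc 0) $$ (Suc 0,0) = \<i>"
  "pauli (Suc 0) $$ (Suc 0,Suc 0) = 0"
  "pauli 2 $$ (0,0) = 1" "pauli 2 $$ (0,Suc 0) = 0" "pauli 2 $$ (Suc 0,0) = 0" "pauli 2 $$ (Suc 0,Suc 0) = -1"
  by (simp_all add: pauli_def mat_of_rows_list_def)

definition bmap :: "real^3^3 \<Rightarrow> real^3 \<Rightarrow> complex mat \<Rightarrow> complex mat" where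
  "bmap M c = bloch_map (of_mat3 M) (of_vec3 c)"

lemma bloch_map_eq_bmap:
  "M \<in> carrier_mat 3 3 \<Longrightarrow> c \<in> carrier_vec 3 \<Longrightarrow> bloch_map M c = bmap (mat3 M) (vec3 c)"
  by (simp add: bmap_def)

text \<open>Complex-valued, because the Bloch map is extended linearly to all matrices, in
  particular to the non-Hermitian matrix units that occur in \<open>ext_id\<close>.\<close>

definition cbloch :: "complex mat \<Rightarrow> 3 \<Rightarrow> complex" where
  "cbloch A i = mtrace (A * pauli (nat3 i))"

definition bcoord :: "real^3^3 \<Rightarrow> real^3 \<Rightarrow> complex mat \<Rightarrow> 3 \<Rightarrow> complex" where
  "bcoord M c A i = (\<Sum>j\<in>UNIV. complex_of_real (M $ i $ j) * cbloch A j) + complex_of_real (c $ i) * mtrace A"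

lemma bmap_dim [simp]: "dim_row (bmap M c A) = 2" "dim_col (bmap M c A) = 2"
  by (simp_all add: bmap_def bloch_map_def)

lemma bmap_index:
  assumes "a < 2" "b < 2"
  shows "bmap M c A $$ (a,b) = (1/2) * (mtrace A * (if a = b then 1 else 0) +
     (\<Sum>i\<in>UNIV. bcoord M c A i * pauli (nat3 i) $$ (a,b)))"
  using assms
  by (simp add: bmap_def bloch_map_def of_mat3_def of_vec3_def bcoord_def cbloch_def sum_less_3 sum_3)

lemma mtrace_bmap [simp]: "mtrace (bmap M c A) = mtrace A"
  by (simp add: mtrace_def[of "bmap M c A"] sum_less_2 bmap_index sum_3 field_simps)

lemma cbloch_2:
  assumes "A \<in> carrier_mat 2 2"
  shows "cbloch A 1 = A $$ (0,1) + A $$ (1,0)" "cbloch A 2 = \<i> * (A $$ (0,1) - A $$ (1,0))"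
    "cbloch A 3 = A $$ (0,0) - A $$ (1,1)"
  using assms
  by (simp_all add: cbloch_def mtrace_def sum_less_2 scalar_prod_def atLeast0LessThan algebra_simps)

lemma cbloch_bmap [simp]: "cbloch (bmap M c A) i = bcoord M c A i"
proof -
  have "bmap M c A \<in> carrier_mat 2 2"
    by (intro carrier_matI) simp_all
  note * = cbloch_2[OF this]
  show ?thesis
    using exhaust_3[of i] by (auto simp: * bmap_index sum_3 field_simps)
qed

lemma bmap_comp: "bmap M c (bmap N d A) = bmap (M ** N) (M *v d + c) A"
proof -
  have "bcoord M c (bmap N d A) i = bcoord (M ** N) (M *v d + c) A i" for i
    by (simp add: bcoord_def[of M] bcoord_def[of "M ** N"] matrix_matrix_mult_def matrix_vector_mult_def sum_3)
      (simp add: bcoord_def sum_3 algebra_simps)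
  then show ?thesis
    by (intro eq_matI) (simp_all add: bmap_index)
qed

text \<open>Lets a power of the channel be handled as a single pair whose affine and linear parts
  are the iterates. The power must be positive: the zeroth one is the identity on matrices of every
  size, whereas \<open>bmap\<close> always returns a 2 by 2 matrix.\<close>

lemma bmap_funpow:
  assumes "1 \<le> k"
  obtains N d where "bmap M c ^^ k = bmap N d" "\<forall>x. N *v x + d = ((\<lambda>x. M *v x + c) ^^ k) x"
    "\<forall>x. N *v x = (((*v) M) ^^ k) x"
proof -
  have "\<exists>N d. bmap M c ^^ k = bmap N d \<and> (\<forall>x. N *v x + d = ((\<lambda>x. M *v x + c) ^^ k) x)
      \<and> (\<forall>x. N *v x = (((*v) M) ^^ k) x)"
    using assms
  proof (induction k rule: dec_induct)
    case base
    then show ?case by (intro exI[of _ M] exI[of _ c]) auto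
  next
    case (step k)
    then obtain N d where *: "bmap M c ^^ k = bmap N d" "\<forall>x. N *v x + d = ((\<lambda>x. M *v x + c) ^^ k) x"
      "\<forall>x. N *v x = (((*v) M) ^^ k) x"
      by blast
    have "bmap M c ^^ Suc k = bmap (M ** N) (M *v d + c)"
      by (auto simp: *(1) bmap_comp)
    moreover have "(M ** N) *v x + (M *v d + c) = ((\<lambda>x. M *v x + c) ^^ Suc k) x" for x
      by (simp flip: *(2)[rule_format] add: matrix_vector_mul_assoc matrix_vector_right_distrib)
    moreover have "(M ** N) *v x = (((*v) M) ^^ Suc k) x" for x
      by (simp flip: *(3)[rule_format] add: matrix_vector_mul_assoc)
    ultimately show ?case by blast
  qed
  then show thesis using that by blast
qed

subsection \<open>Spinors\<close>

definition sprod :: "(nat \<Rightarrow> complex) \<Rightarrow> (nat \<Rightarrow> complex) \<Rightarrow> complex" where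
  "sprod x y = (\<Sum>a<2. cnj (x a) * y a)"

text \<open>The vector of matrix elements of the Pauli matrices between two spinors. For
  \<open>x = y\<close> it is the Bloch vector of the unnormalised pure state of \<open>x\<close>;
  for distinct spinors it enters the off-diagonal Choi entries.\<close>

definition spauli :: "(nat \<Rightarrow> complex) \<Rightarrow> (nat \<Rightarrow> complex) \<Rightarrow> 3 \<Rightarrow> complex" where
  "spauli x y i = (\<Sum>a<2. \<Sum>b<2. cnj (x a) * pauli (nat3 i) $$ (a,b) * y b)"

lemma sprod_explicit: "sprod x y = cnj (x 0) * y 0 + cnj (x (Suc 0)) * y (Suc 0)"
  by (simp add: sprod_def sum_less_2)

lemma spauli_explicit:
  "spauli x y 1 = cnj (x 0) * y (Suc 0) + cnj (x (Suc 0)) * y 0"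
  "spauli x y 2 = \<i> * (cnj (x (Suc 0)) * y 0 - cnj (x 0) * y (Suc 0))"
  "spauli x y 3 = cnj (x 0) * y 0 - cnj (x (Suc 0)) * y (Suc 0)"
  by (simp_all add: spauli_def sum_less_2 algebra_simps)

definition spin_vec :: "(nat \<Rightarrow> complex) \<Rightarrow> real^3" where
  "spin_vec x = (\<chi> i. Re (spauli x x i))"

lemma spin_vec_index: "spin_vec x $ i = Re (spauli x x i)"
  by (simp add: spin_vec_def)

lemma spauli_self: "spauli x x i = complex_of_real (spin_vec x $ i)"
proof -
  have "Im (spauli x x i) = 0"
    using exhaust_3[of i] by (auto simp: spauli_explicit algebra_simps)
  then show ?thesis
    by (simp add: spin_vec_def complex_eq_iff)
qed

text \<open>This is the Hopf map from spinors to vectors; after squaring, both sides are the same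
  quartic polynomial in the four real coordinates.\<close>

lemma norm_spin_vec: "norm (spin_vec x) = (cmod (x 0))\<^sup>2 + (cmod (x (Suc 0)))\<^sup>2"
proof -
  obtain a b c d where x: "x 0 = Complex a b" "x (Suc 0) = Complex c d"
    by (meson complex.exhaust)
  have "(norm (spin_vec x))\<^sup>2 = inner (spin_vec x) (spin_vec x)"
    by (rule power2_norm_eq_inner)
  also have "\<dots> = ((cmod (x 0))\<^sup>2 + (cmod (x (Suc 0)))\<^sup>2)\<^sup>2"
    by (simp add: inner_vec_def sum_3 spin_vec_index spauli_explicit x cmod_power2)
      (simp add: power2_eq_square algebra_simps)
  finally show ?thesis
    by (simp add: power2_eq_iff_nonneg)
qed

text \<open>Surjectivity of the Hopf map onto the sphere, by its explicit section with real first
  component. The section breaks down at the south pole, which gets its own spinor.\<close>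

lemma spinor_exists:
  assumes "norm p = 1"
  obtains x where "spin_vec x = p" "sprod x x = 1"
proof -
  have p: "p$1 * p$1 + p$2 * p$2 + p$3 * p$3 = 1"
    using assms by (simp add: norm_eq_1 inner_vec_def sum_3)
  have "\<exists>x. spin_vec x = p"
  proof (cases "p$3 = -1")
    case True
    with p have "p$1 = 0" "p$2 = 0"
      by (auto simp: sum_squares_eq_zero_iff)
    with True have "spin_vec (\<lambda>a. if a = 0 then 0 else 1) = p"
      by (auto simp: spin_vec_def Finite_Cartesian_Product.vec_eq_iff forall_3 spauli_explicit)
    then show ?thesis by blast
  next
    case False
    have "p$3 * p$3 \<le> 1"
      using p by (smt (verit) zero_le_square)
    then have "\<bar>p$3\<bar> \<le> 1"
      by (metis abs_square_le_1 power2_eq_square)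
    with False have p3: "1 + p$3 > 0" by simp
    \<comment> \<open>The cosine of half the polar angle of \<open>p\<close>.\<close>
    define r where "r = sqrt ((1 + p$3) / 2)"
    have r: "r > 0" "r * r = (1 + p$3) / 2"
      using p3 by (auto simp: r_def)
    define x where "x a = (if a = 0 then complex_of_real r else Complex (p$1 / (2*r)) (p$2 / (2*r)))" for a :: nat
    have q: "p$1 * p$1 + p$2 * p$2 = (1 - p$3) * (1 + p$3)"
      using p by (simp add: algebra_simps)
    have "(p$1 / (2*r)) * (p$1 / (2*r)) + (p$2 / (2*r)) * (p$2 / (2*r)) = (p$1 * p$1 + p$2 * p$2) / (4 * (r * r))"
      by (simp add: add_divide_distrib)
    also have "\<dots> = (1 - p$3) / 2"
      using p3 by (simp add: r q field_simps)
    finally have s: "(p$1 / (2*r)) * (p$1 / (2*r)) + (p$2 / (2*r)) * (p$2 / (2*r)) = (1 - p$3) / 2" .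
    have "spin_vec x = p"
      unfolding spin_vec_def Finite_Cartesian_Product.vec_eq_iff forall_3
      using r(1) s by (simp add: spauli_explicit x_def r(2) algebra_simps)
    then show ?thesis by blast
  qed
  then obtain x where x: "spin_vec x = p" by blast
  moreover have "sprod x x = 1"
  proof -
    have "sprod x x = complex_of_real ((cmod (x 0))\<^sup>2 + (cmod (x (Suc 0)))\<^sup>2)"
      unfolding of_real_add complex_norm_square sprod_explicit by (simp add: mult.commute)
    then show ?thesis
      by (simp only: x assms of_real_1 flip: norm_spin_vec)
  qed
  ultimately show thesis using that by blast
qed

definition bstate :: "real^3 \<Rightarrow> complex mat" where
  "bstate s = Matrix.mat 2 2 (\<lambda>(a,b). (1/2) * ((if a = b then 1 else 0) +
     (\<Sum>i\<in>UNIV. complex_of_real (s $ i) * pauli (nat3 i) $$ (a,b))))"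

lemma bstate_index [simp]:
  "bstate s $$ (0,0) = (1 + s$3) / 2" "bstate s $$ (Suc 0,Suc 0) = (1 - s$3) / 2"
  "bstate s $$ (0,Suc 0) = (s$1 - \<i> * s$2) / 2" "bstate s $$ (Suc 0,0) = (s$1 + \<i> * s$2) / 2"
  by (simp_all add: bstate_def sum_3 algebra_simps)

lemma bstate_dim [simp]: "dim_row (bstate s) = 2" "dim_col (bstate s) = 2" "bstate s \<in> carrier_mat 2 2"
  by (simp_all add: bstate_def)

text \<open>Reduces positivity of a qubit state to comparing \<open>inner s n\<close> with
  \<open>norm n\<close>, that is, to Cauchy-Schwarz.\<close>

lemma bstate_form:
  "(\<Sum>i<2. \<Sum>j<2. cnj (v i) * bstate s $$ (i,j) * v j) =
     complex_of_real ((norm (spin_vec v) + inner s (spin_vec v)) / 2)"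
proof -
  obtain a b c d where v: "v 0 = Complex a b" "v (Suc 0) = Complex c d"
    by (meson complex.exhaust)
  show ?thesis
    by (simp add: norm_spin_vec sum_less_2 inner_vec_def sum_3 spin_vec_index spauli_explicit complex_eq_iff v cmod_power2)
      (simp add: power2_eq_square field_simps)
qed

lemma mtrace_bstate [simp]: "mtrace (bstate s) = 1"
  by (simp add: mtrace_def sum_less_2 field_simps)

lemma density_bstate:
  assumes "norm s \<le> 1"
  shows "density 2 (bstate s)"
proof -
  have "- inner s (spin_vec v) \<le> norm (spin_vec v)" for v
    using Cauchy_Schwarz_ineq2[of s "spin_vec v"] mult_right_mono[OF assms norm_ge_zero[of "spin_vec v"]]
    by linarith
  then have "0 \<le> norm (spin_vec v) + inner s (spin_vec v)" for v
    by (smt (verit))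
  then show ?thesis
    by (simp add: density_def psd_def bstate_form)
qed

lemma bstate_spin_vec:
  assumes "sprod x x = 1" "a < 2" "b < 2"
  shows "bstate (spin_vec x) $$ (a,b) = x a * cnj (x b)"
proof -
  obtain c d e f where v: "x 0 = Complex c d" "x (Suc 0) = Complex e f"
    by (meson complex.exhaust)
  have 1: "c * c + d * d + (e * e + f * f) = 1"
    using assms(1) by (simp add: sprod_explicit v complex_eq_iff)
  have "a = 0 \<or> a = Suc 0" "b = 0 \<or> b = Suc 0"
    using assms by auto
  then show ?thesis
    using 1 by (auto simp: spin_vec_index spauli_explicit complex_eq_iff v field_simps)
qed

text \<open>Reality of the form at the test vectors e0, e1, e0 + e1 and e0 + i e1 forces
  Hermiticity, so \<open>A\<close> has a real Bloch vector \<open>s\<close>. A spinor pointing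
  opposite to \<open>s\<close> gives the form the value \<open>(1 - norm s) / 2\<close>, which
  bounds the length of \<open>s\<close>.\<close>

lemma density_2_bstate:
  assumes "density 2 A"
  obtains s where "norm s \<le> 1" "A = bstate s"
proof -
  have A: "A \<in> carrier_mat 2 2" "A $$ (0,0) + A $$ (Suc 0, Suc 0) = 1"
    using assms by (auto simp: density_def psd_def mtrace_def sum_less_2)
  have r: "(\<Sum>i<2. \<Sum>j<2. cnj (v i) * A $$ (i,j) * v j) \<in> \<real>"
    "0 \<le> Re (\<Sum>i<2. \<Sum>j<2. cnj (v i) * A $$ (i,j) * v j)" for v
    using assms by (auto simp: density_def psd_def)
  have i1: "Im (A $$ (0,0)) = 0"
    using r(1)[of "\<lambda>a. if a = 0 then 1 else 0"] by (simp add: sum_less_2 complex_is_Real_iff)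
  have i2: "Im (A $$ (Suc 0,Suc 0)) = 0"
    using r(1)[of "\<lambda>a. if a = 0 then 0 else 1"] by (simp add: sum_less_2 complex_is_Real_iff)
  have i3: "Im (A $$ (0,Suc 0)) + Im (A $$ (Suc 0,0)) = 0"
    using r(1)[of "\<lambda>a. 1"] i1 i2 by (simp add: sum_less_2 complex_is_Real_iff)
  have i4: "Re (A $$ (0,Suc 0)) = Re (A $$ (Suc 0,0))"
    using r(1)[of "\<lambda>a. if a = 0 then 1 else \<i>"] i1 i2 by (simp add: sum_less_2 complex_is_Real_iff)
  define s :: "real^3" where "s = vector [2 * Re (A $$ (0,Suc 0)), 2 * Im (A $$ (Suc 0,0)), 2 * Re (A $$ (0,0)) - 1]"
  have "Re (A $$ (0,0)) + Re (A $$ (Suc 0, Suc 0)) = 1"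
    using arg_cong[OF A(2), of Re] by simp
  then have eq: "A = bstate s"
  proof (intro eq_matI)
    fix a b assume "Re (A $$ (0,0)) + Re (A $$ (Suc 0, Suc 0)) = 1"
      "a < dim_row (bstate s)" "b < dim_col (bstate s)"
    then have "a = 0 \<or> a = Suc 0" "b = 0 \<or> b = Suc 0" "Re (A $$ (Suc 0, Suc 0)) = 1 - Re (A $$ (0,0))"
      by auto
    then show "A $$ (a,b) = bstate s $$ (a,b)"
      using i1 i2 i3 i4 by (auto simp: complex_eq_iff s_def)
  qed (use A in auto)
  have "norm s \<le> 1"
  proof (rule ccontr)
    assume "\<not> norm s \<le> 1"
    then have n: "norm s > 1" by simp
    have s0: "s \<noteq> 0"
      using n by auto
    then have "norm (- (s /\<^sub>R norm s)) = 1"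
      by simp
    then obtain x where x: "spin_vec x = - (s /\<^sub>R norm s)" "sprod x x = 1"
      using spinor_exists by blast
    have "norm (spin_vec x) = 1" "inner s (spin_vec x) = - norm s"
      using s0 by (auto simp: x(1) power2_norm_eq_inner[symmetric] power2_eq_square)
    then show False
      using r(2)[of x] n unfolding eq bstate_form by simp
  qed
  then show thesis using that eq by blast
qed

subsection \<open>Entanglement breaking and measure-and-prepare maps\<close>

lemma sum_double_index: "(\<Sum>r<2*n. g r) = (\<Sum>i<n. g i) + (\<Sum>i<n. g (n + i) :: 'a::comm_monoid_add)"
  for n :: nat
proof -
  have "(\<Sum>r<n+m. g r) = (\<Sum>i<n. g i) + (\<Sum>i<m. g (n + i))" for m :: nat
    by (induction m) (simp_all add: add.assoc)
  from this[of n] show ?thesis by (simp add: mult_2)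
qed

lemma unit2_dim [simp]: "dim_row (unit2 a b) = 2" "dim_col (unit2 a b) = 2"
  by (simp_all add: unit2_def)

lemma cbloch_unit2: "a < 2 \<Longrightarrow> b < 2 \<Longrightarrow> cbloch (unit2 a b) j = pauli (nat3 j) $$ (b,a)"
  by (auto simp: cbloch_def mtrace_def sum_less_2 scalar_prod_def atLeast0LessThan unit2_def less_2_cases_iff)

lemma mtrace_unit2: "a < 2 \<Longrightarrow> b < 2 \<Longrightarrow> mtrace (unit2 a b) = (if a = b then 1 else 0)"
  by (auto simp: mtrace_def sum_less_2 unit2_def less_2_cases_iff)

lemma psd_carrier: "psd n A \<Longrightarrow> A \<in> carrier_mat n n"
  by (simp add: psd_def)

lemma psd_form_on_subset:
  assumes "psd n A" "S \<subseteq> {..<n}"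
  shows "(\<Sum>k\<in>S. \<Sum>l\<in>S. cnj (v k) * A $$ (k,l) * v l) \<in> \<real>"
    "0 \<le> Re (\<Sum>k\<in>S. \<Sum>l\<in>S. cnj (v k) * A $$ (k,l) * v l)"
proof -
  define u where "u k = (if k \<in> S then v k else 0)" for k
  have "(\<Sum>k<n. \<Sum>l<n. cnj (u k) * A $$ (k,l) * u l) = (\<Sum>k\<in>S. \<Sum>l<n. cnj (u k) * A $$ (k,l) * u l)"
    using assms(2) by (intro sum.mono_neutral_right) (auto simp: u_def)
  also have "\<dots> = (\<Sum>k\<in>S. \<Sum>l\<in>S. cnj (v k) * A $$ (k,l) * v l)"
    using assms(2) by (intro sum.cong refl sum.mono_neutral_cong_right) (auto simp: u_def)
  finally have eq: "(\<Sum>k<n. \<Sum>l<n. cnj (u k) * A $$ (k,l) * u l) = (\<Sum>k\<in>S. \<Sum>l\<in>S. cnj (v k) * A $$ (k,l) * v l)" .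
  show "(\<Sum>k\<in>S. \<Sum>l\<in>S. cnj (v k) * A $$ (k,l) * v l) \<in> \<real>"
    "0 \<le> Re (\<Sum>k\<in>S. \<Sum>l\<in>S. cnj (v k) * A $$ (k,l) * v l)"
    unfolding eq[symmetric] using assms(1) by (simp_all add: psd_def del: Re_sum)
qed

lemma psd_diag:
  assumes "psd n A" "i < n"
  shows "A $$ (i,i) \<in> \<real>" "0 \<le> Re (A $$ (i,i))"
  using psd_form_on_subset[OF assms(1), of "{i}" "\<lambda>_. 1"] assms(2) by simp_all

text \<open>On the vector e_i + z e_j the form is real-linear in \<open>z\<close>, so nonnegativity
  at opposite values of \<open>z\<close> makes it vanish; the values 1, -1, i, -i determine the
  entry.\<close>

lemma psd_zero_diag:
  assumes "psd n A" "i < n" "j < n" "A $$ (i,i) = 0" "A $$ (j,j) = 0"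
  shows "A $$ (i,j) = 0"
proof (cases "i = j")
  case False
  have *: "z * A $$ (i,j) + cnj z * A $$ (j,i) \<in> \<real>" "0 \<le> Re (z * A $$ (i,j) + cnj z * A $$ (j,i))" for z
    using psd_form_on_subset[OF assms(1), of "{i,j}" "\<lambda>k. if k = i then 1 else z"] assms False
    by (auto simp: mult.commute)
  show ?thesis
    using *[of 1] *(2)[of "-1"] *[of \<i>] *(2)[of "-\<i>"]
    by (auto simp: complex_eq_iff complex_is_Real_iff)
qed (use assms in simp)

lemma psd_trace:
  assumes "psd n A"
  shows "mtrace A = complex_of_real (Re (mtrace A))" "0 \<le> Re (mtrace A)"
    "mtrace A = 0 \<Longrightarrow> i < n \<Longrightarrow> j < n \<Longrightarrow> A $$ (i,j) = 0"
proof -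
  have n: "dim_row A = n"
    using psd_carrier[OF assms] by simp
  have r: "Im (A $$ (i,i)) = 0" if "i < n" for i
    using psd_diag(1)[OF assms that] by (simp add: complex_is_Real_iff)
  have p: "0 \<le> Re (A $$ (i,i))" if "i < n" for i
    using psd_diag(2)[OF assms that] .
  show "mtrace A = complex_of_real (Re (mtrace A))"
    by (simp add: complex_eq_iff mtrace_def n r)
  show "0 \<le> Re (mtrace A)"
    by (auto simp: mtrace_def n intro!: sum_nonneg p)
  assume "mtrace A = 0" "i < n" "j < n"
  then have "(\<Sum>i<n. Re (A $$ (i,i))) = 0"
    by (metis Re_sum mtrace_def n zero_complex.sel(1))
  then have "\<forall>i\<in>{..<n}. Re (A $$ (i,i)) = 0"
    by (subst (asm) sum_nonneg_eq_0_iff) (auto simp: p)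
  with r have "A $$ (i,i) = 0" if "i < n" for i
    using that by (simp add: complex_eq_iff)
  then show "A $$ (i,j) = 0"
    using psd_zero_diag[OF assms] \<open>i < n\<close> \<open>j < n\<close> by blast
qed

text \<open>The matrix is the unnormalised state left on the second factor after the first is found
  in the pure state \<open>x\<close>. Its form at \<open>v\<close> is the form of \<rho> at the
  product vector of \<open>x\<close> and \<open>v\<close>.\<close>

lemma psd_contract:
  assumes "psd (2*n) \<rho>"
  shows "psd n (Matrix.mat n n (\<lambda>(i,j). \<Sum>a<2. \<Sum>b<2. cnj (x a) * x b * \<rho> $$ (a*n+i, b*n+j)))"
    (is "psd n ?R")
proof -
  have "(\<Sum>i<n. \<Sum>j<n. cnj (v i) * ?R $$ (i,j) * v j) =
     (\<Sum>r<2*n. \<Sum>s<2*n. cnj (V r) * \<rho> $$ (r,s) * V s)"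
    if "V = (\<lambda>r. if r < n then x 0 * v r else x (Suc 0) * v (r - n))" for v V
    unfolding that sum_double_index by (simp add: sum_less_2 algebra_simps sum.distrib)
  then show ?thesis
    using assms unfolding psd_def by auto
qed

text \<open>The conditions on \<open>w\<close> and \<open>u\<close> say that the effects
  \<open>w k * (1 + u k . sigma)\<close> form a measurement; outcome \<open>k\<close> prepares the
  state \<open>s k\<close>. Since \<open>u k\<close> is a unit vector, each effect is
  \<open>2 * w k\<close> times the projector onto a spinor \<open>x k\<close>. The output is
  therefore a mixture over \<open>k\<close> of the prepared state tensored with the conditional
  state of the second factor.\<close>

lemma measure_prepare_entanglement_breaking:
  fixes w :: "nat \<Rightarrow> real" and u s :: "nat \<Rightarrow> real^3"
  assumes w: "\<And>k. k < m \<Longrightarrow> 0 \<le> w k" "(\<Sum>k<m. w k) = 1"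
    and us: "\<And>k. k < m \<Longrightarrow> norm (u k) = 1" "\<And>k. k < m \<Longrightarrow> norm (s k) \<le> 1"
    and u0: "(\<Sum>k<m. w k *\<^sub>R u k) = 0"
    and d: "d = (\<Sum>k<m. w k *\<^sub>R s k)"
    and N: "\<And>i j. N $ i $ j = (\<Sum>k<m. w k * s k $ i * u k $ j)"
  shows "entanglement_breaking (bmap N d)"
  unfolding entanglement_breaking_def
proof (intro allI impI)
  fix n :: nat and \<rho> assume n: "1 \<le> n" and "density (2*n) \<rho>"
  then have \<rho>: "psd (2*n) \<rho>" "mtrace \<rho> = 1" "dim_row \<rho> = 2*n"
    by (auto simp: density_def psd_def)
  have "\<exists>x. k < m \<longrightarrow> spin_vec x = u k \<and> sprod x x = 1" for k
    using spinor_exists[of "u k"] us(1)[of k] by blast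
  then obtain x where x: "\<And>k. k < m \<Longrightarrow> spin_vec (x k) = u k" "\<And>k. k < m \<Longrightarrow> sprod (x k) (x k) = 1"
    by metis
  have meas: "(if a = b then 1 else 0) + (\<Sum>j\<in>UNIV. complex_of_real (u k $ j) * pauli (nat3 j) $$ (b,a))
      = 2 * (x k b * cnj (x k a))" if "k < m" "a < 2" "b < 2" for k a b
    using bstate_spin_vec[OF x(2)[OF that(1)], of b a] that by (cases "a = b") (auto simp: x bstate_def)
  \<comment> \<open>Completeness of the measurement: the effects add up to the identity.\<close>
  have wx: "(\<Sum>k<m. w k * (2 * (x k b * cnj (x k a)))) = (if a = b then 1 else 0)" if "a < 2" "b < 2" for a b
  proof -
    have c: "(\<Sum>k<m. complex_of_real (w k) * complex_of_real (u k $ j)) = 0" for j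
      using arg_cong[OF u0, of "\<lambda>v. complex_of_real (v $ j)"] by simp
    have "(\<Sum>k<m. w k * (2 * (x k b * cnj (x k a)))) =
       (\<Sum>k<m. w k * ((if a = b then 1 else 0) + (\<Sum>j\<in>UNIV. complex_of_real (u k $ j) * pauli (nat3 j) $$ (b,a))))"
      using that by (intro sum.cong) (auto simp: meas)
    also have "\<dots> = (\<Sum>k<m. complex_of_real (w k)) * (if a = b then 1 else 0) +
        (\<Sum>j\<in>UNIV. (\<Sum>k<m. complex_of_real (w k) * complex_of_real (u k $ j)) * pauli (nat3 j) $$ (b,a))"
      by (simp add: distrib_left sum.distrib sum_distrib_left sum_distrib_right sum_3 mult.assoc)
    also have "\<dots> = (if a = b then 1 else 0)"
      using w(2) by (simp add: c flip: of_real_sum)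
    finally show ?thesis .
  qed
  have f: "bmap N d (unit2 a b) $$ (p,q) = (\<Sum>k<m. w k * (2 * (x k b * cnj (x k a))) * bstate (s k) $$ (p,q))"
    if ab: "a < 2" "b < 2" and pq: "p < 2" "q < 2" for a b p q
  proof -
    have "bcoord N d (unit2 a b) i = (\<Sum>k<m. w k * (2 * (x k b * cnj (x k a))) * s k $ i)" for i
    proof -
      have "bcoord N d (unit2 a b) i = (\<Sum>k<m. w k * ((if a = b then 1 else 0) +
          (\<Sum>j\<in>UNIV. complex_of_real (u k $ j) * pauli (nat3 j) $$ (b,a))) * s k $ i)"
        using ab by (simp add: bcoord_def cbloch_unit2 mtrace_unit2 N d sum_3 algebra_simps sum.distrib sum_distrib_left)
      also have "\<dots> = (\<Sum>k<m. w k * (2 * (x k b * cnj (x k a))) * s k $ i)"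
        using ab by (intro sum.cong) (auto simp: meas)
      finally show ?thesis .
    qed
    moreover have "mtrace (unit2 a b) = (\<Sum>k<m. w k * (2 * (x k b * cnj (x k a))))"
      using ab by (simp add: mtrace_unit2 wx)
    ultimately show ?thesis
      using pq by (simp add: bmap_index bstate_def sum_3 sum_distrib_left sum_distrib_right sum.distrib algebra_simps)
  qed
  define R where "R k = Matrix.mat n n (\<lambda>(i,j). \<Sum>a<2. \<Sum>b<2. cnj (x k a) * x k b * \<rho> $$ (a*n+i, b*n+j))" for k
  have R: "psd n (R k)" for k
    unfolding R_def by (rule psd_contract[OF \<rho>(1)])
  define t where "t k = Re (mtrace (R k))" for k
  have t: "mtrace (R k) = complex_of_real (t k)" "0 \<le> t k" for k
    using psd_trace[OF R] by (auto simp: t_def)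
  \<comment> \<open>An arbitrary density matrix for outcomes of probability zero. There
    \<open>R k\<close> vanishes and cannot be normalised, but separability still asks for a
    state.\<close>
  define \<tau>0 where "\<tau>0 = Matrix.mat n n (\<lambda>(i,j). if i = 0 \<and> j = 0 then 1 else (0::complex))"
  have \<tau>0: "density n \<tau>0"
  proof -
    have "(\<Sum>i<n. \<Sum>j<n. cnj (v i) * \<tau>0 $$ (i,j) * v j) = (\<Sum>i<n. \<Sum>j<n. if j = 0 then if i = 0 then cnj (v i) * v j else 0 else 0)" for v
      by (intro sum.cong) (auto simp: \<tau>0_def)
    also have "\<dots> v = cnj (v 0) * v 0" for v
      using n by (simp add: sum.delta)
    finally have "(\<Sum>i<n. \<Sum>j<n. cnj (v i) * \<tau>0 $$ (i,j) * v j) = complex_of_real ((cmod (v 0))\<^sup>2)" for v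
      by (simp add: complex_norm_square mult.commute del: of_real_power)
    then show ?thesis
      using n by (simp add: density_def psd_def mtrace_def) (simp add: \<tau>0_def)
  qed
  define \<tau> where "\<tau> k = (if t k = 0 then \<tau>0 else Matrix.mat n n (\<lambda>(i,j). R k $$ (i,j) / t k))" for k
  have \<tau>: "density n (\<tau> k)" for k
  proof (cases "t k = 0")
    case False
    have "mtrace (\<tau> k) = mtrace (R k) / t k"
      using False psd_carrier[OF R, of k] by (simp add: mtrace_def \<tau>_def sum_divide_distrib)
    moreover have "(\<Sum>i<n. \<Sum>j<n. cnj (v i) * \<tau> k $$ (i,j) * v j) =
      (\<Sum>i<n. \<Sum>j<n. cnj (v i) * R k $$ (i,j) * v j) / complex_of_real (t k)" for v
      using False by (simp add: \<tau>_def sum_divide_distrib)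
    ultimately show ?thesis
      using R[of k] False t[of k] unfolding density_def psd_def
      by (auto simp: \<tau>_def complex_is_Real_iff Im_divide_of_real Re_divide_of_real)
  qed (simp add: \<tau>_def \<tau>0)
  have R\<tau>: "R k $$ (i,j) = t k * \<tau> k $$ (i,j)" if "i < n" "j < n" for k i j
    using psd_trace(3)[OF R[of k] _ that] that t(1)[of k] by (auto simp: \<tau>_def)
  \<comment> \<open>The outcome probabilities are \<open>2 * w k * t k\<close>; by completeness they
    add up to the trace of \<rho>.\<close>
  have "complex_of_real (\<Sum>k<m. 2 * w k * t k) = (\<Sum>k<m. w k * 2 * mtrace (R k))"
    by (simp add: t(1) mult_ac)
  also have "\<dots> = (\<Sum>k<m. \<Sum>i<n. \<Sum>a<2. \<Sum>b<2. (w k * (2 * (x k b * cnj (x k a)))) * \<rho> $$ (a*n+i, b*n+i))"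
    by (simp add: mtrace_def R_def sum_distrib_left mult_ac)
  also have "\<dots> = (\<Sum>i<n. \<Sum>a<2. \<Sum>b<2. (\<Sum>k<m. w k * (2 * (x k b * cnj (x k a)))) * \<rho> $$ (a*n+i, b*n+i))"
    by (subst sum.swap) (simp only: sum_less_2 sum_distrib_right sum.distrib)
  also have "\<dots> = (\<Sum>i<n. \<Sum>a<2. \<Sum>b<2. (if a = b then 1 else 0) * \<rho> $$ (a*n+i, b*n+i))"
    by (intro sum.cong refl) (simp add: wx)
  also have "\<dots> = mtrace \<rho>"
    unfolding mtrace_def \<rho>(3) sum_double_index by (simp add: sum_less_2 sum.distrib)
  finally have "(\<Sum>k<m. 2 * w k * t k) = 1"
    by (simp only: \<rho>(2) of_real_eq_1_iff)
  moreover have "ext_id (bmap N d) n \<rho> = Matrix.mat (2*n) (2*n)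
      (\<lambda>(r,q). \<Sum>k<m. complex_of_real (2 * w k * t k) * kron2 n (bstate (s k)) (\<tau> k) $$ (r,q))"
  proof (rule eq_matI)
    fix r q assume "r < dim_row (Matrix.mat (2*n) (2*n)
      (\<lambda>(r,q). \<Sum>k<m. complex_of_real (2 * w k * t k) * kron2 n (bstate (s k)) (\<tau> k) $$ (r,q)))"
      "q < dim_col (Matrix.mat (2*n) (2*n)
      (\<lambda>(r,q). \<Sum>k<m. complex_of_real (2 * w k * t k) * kron2 n (bstate (s k)) (\<tau> k) $$ (r,q)))"
    then have rq: "r < 2*n" "q < 2*n" by simp_all
    then have d2: "r div n < 2" "q div n < 2" "r mod n < n" "q mod n < n"
      using n by (auto simp: less_mult_imp_div_less)
    have "ext_id (bmap N d) n \<rho> $$ (r,q) = (\<Sum>a<2. \<Sum>b<2. (\<Sum>k<m. w k * (2 * (x k b * cnj (x k a))) *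
        bstate (s k) $$ (r div n, q div n)) * \<rho> $$ (a*n + r mod n, b*n + q mod n))"
      using rq unfolding ext_id_def by (simp add: f d2)
    also have "\<dots> = (\<Sum>k<m. 2 * w k * bstate (s k) $$ (r div n, q div n) * R k $$ (r mod n, q mod n))"
      using d2 by (simp add: R_def sum_less_2 sum_distrib_right sum_distrib_left distrib_left distrib_right
          sum.distrib mult_ac)
    finally show "ext_id (bmap N d) n \<rho> $$ (r,q) = Matrix.mat (2*n) (2*n)
      (\<lambda>(r,q). \<Sum>k<m. complex_of_real (2 * w k * t k) * kron2 n (bstate (s k)) (\<tau> k) $$ (r,q)) $$ (r,q)"
      using rq d2 by (simp add: kron2_def R\<tau> mult_ac)
  qed (simp_all add: ext_id_def)
  ultimately show "separable n (ext_id (bmap N d) n \<rho>)"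
    unfolding separable_def
    by (intro exI[of _ m] exI[of _ "\<lambda>k. 2 * w k * t k"] exI[of _ "\<lambda>k. bstate (s k)"] exI[of _ \<tau>])
      (use w(1) t(2) us(2) in \<open>auto simp: density_bstate \<tau>\<close>)
qed

section \<open>The Bell state, and measure-and-prepare form from separability\<close>

lemma sum_less_4: "(\<Sum>k<4. f k) = f 0 + f (Suc 0) + f 2 + (f 3 :: 'a::comm_monoid_add)"
  by (simp add: eval_nat_numeral)

text \<open>Left unnormalised, so that applying the map to one half yields the Choi matrix with the
  images of the matrix units as its exact entries. Its half is the density matrix to which
  entanglement breaking applies.\<close>

definition bell :: "complex mat" where
  "bell = Matrix.mat 4 4 (\<lambda>(r,s). if (r = 0 \<or> r = 3) \<and> (s = 0 \<or> s = 3) then 1 else 0)"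

lemma psd_bell: "psd 4 bell"
proof -
  have "(\<Sum>i<4. \<Sum>j<4. cnj (v i) * bell $$ (i,j) * v j) = complex_of_real ((cmod (v 0 + v 3))\<^sup>2)" for v
    unfolding complex_norm_square by (simp add: sum_less_4 bell_def algebra_simps)
  then show ?thesis
    by (simp add: psd_def bell_def del: of_real_power)
qed

lemma density_half_bell: "density 4 (Matrix.mat 4 4 (\<lambda>rs. bell $$ rs / 2))" (is "density 4 ?A")
proof -
  have "(\<Sum>i<4. \<Sum>j<4. cnj (v i) * ?A $$ (i,j) * v j) = complex_of_real ((cmod (v 0 + v 3))\<^sup>2 / 2)" for v
    unfolding of_real_divide complex_norm_square by (simp add: sum_less_4 bell_def field_simps)
  moreover have "mtrace ?A = 1"
    by (simp add: mtrace_def sum_less_4 bell_def)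
  ultimately show ?thesis
    by (simp add: density_def psd_def del: of_real_divide of_real_power)
qed

lemma ext_id_index:
  assumes "i < 2" "j < 2" "p < 2" "q < 2"
  shows "ext_id f 2 \<rho> $$ (2*p+i, 2*q+j) = (\<Sum>a<2. \<Sum>b<2. f (unit2 a b) $$ (p, q) * \<rho> $$ (2*a + i, 2*b + j))"
  using assms by (simp add: ext_id_def mult.commute)

lemma ext_id_bell:
  assumes "i < 2" "j < 2" "p < 2" "q < 2"
  shows "ext_id f 2 bell $$ (2*p+i, 2*q+j) = f (unit2 i j) $$ (p, q)"
  using assms unfolding ext_id_index[OF assms]
  by (auto simp: less_2_cases_iff sum_less_2 bell_def)

lemma unit_eq_if_inner_eq_1:
  fixes a b :: "'a::real_inner"
  assumes "norm a \<le> 1" "norm b = 1" "inner a b = 1"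
  shows "a = b"
proof -
  have "(norm (a - b))\<^sup>2 = (norm a)\<^sup>2 + 1 - 2"
    using assms by (simp add: power2_norm_eq_inner inner_diff_left inner_diff_right inner_commute norm_eq_1)
  also have "\<dots> \<le> 0"
    using assms(1) by (simp add: abs_square_le_1)
  finally show ?thesis by simp
qed

text \<open>The image of the half Bell state is the Choi state, here a mixture of products of
  \<open>bstate (s k)\<close> and \<open>bstate (t k)\<close>. The second factors turn into effects
  and the first factors into prepared states; pairing the mixture with identity and Pauli matrices
  reads off all Bloch data.\<close>

lemma entanglement_breaking_measure_prepare:
  assumes "entanglement_breaking (bmap N d)"
  obtains m :: nat and w :: "nat \<Rightarrow> real" and u s :: "nat \<Rightarrow> real^3"
  where "\<forall>k<m. 0 \<le> w k" "(\<Sum>k<m. w k) = 1" "\<forall>k<m. norm (u k) \<le> 1" "\<forall>k<m. norm (s k) \<le> 1"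
    "(\<Sum>k<m. w k *\<^sub>R u k) = 0" "d = (\<Sum>k<m. w k *\<^sub>R s k)"
    "\<forall>x. N *v x = (\<Sum>k<m. (w k * inner (u k) x) *\<^sub>R s k)"
proof -
  define X where "X = ext_id (bmap N d) 2 (Matrix.mat 4 4 (\<lambda>rs. bell $$ rs / 2))"
  have X: "X $$ (2*p+i, 2*q+j) = bmap N d (unit2 i j) $$ (p,q) / 2" if "i < 2" "j < 2" "p < 2" "q < 2" for i j p q
    using that unfolding X_def ext_id_index[OF that]
    by (auto simp: less_2_cases_iff sum_less_2 bell_def)
  have "separable 2 X"
    using assms density_half_bell unfolding X_def entanglement_breaking_def by force
  then obtain m :: nat and w \<sigma> \<tau> where w: "\<forall>k<m. 0 \<le> w k \<and> density 2 (\<sigma> k) \<and> density 2 (\<tau> k)" "(\<Sum>k<m. w k) = 1"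
    and Xs: "X = Matrix.mat (2*2) (2*2) (\<lambda>(r,s). \<Sum>k<m. complex_of_real (w k) * kron2 2 (\<sigma> k) (\<tau> k) $$ (r,s))"
    unfolding separable_def by blast
  have "\<exists>s t. k < m \<longrightarrow> norm s \<le> 1 \<and> norm t \<le> 1 \<and> \<sigma> k = bstate s \<and> \<tau> k = bstate t" for k
  proof (cases "k < m")
    case True
    obtain s' where "norm s' \<le> 1" "\<sigma> k = bstate s'"
      using w(1) True density_2_bstate[of "\<sigma> k"] by blast
    moreover obtain t' where "norm t' \<le> 1" "\<tau> k = bstate t'"
      using w(1) True density_2_bstate[of "\<tau> k"] by blast
    ultimately show ?thesis by blast
  qed simp
  then obtain s t where st: "\<And>k. k < m \<Longrightarrow> norm (s k) \<le> 1" "\<And>k. k < m \<Longrightarrow> norm (t k) \<le> 1"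
    "\<And>k. k < m \<Longrightarrow> \<sigma> k = bstate (s k)" "\<And>k. k < m \<Longrightarrow> \<tau> k = bstate (t k)"
    by metis
  have eq: "bmap N d (unit2 i j) $$ (p,q) / 2 = (\<Sum>k<m. w k * (bstate (s k) $$ (p,q) * bstate (t k) $$ (i,j)))"
    if "i < 2" "j < 2" "p < 2" "q < 2" for i j p q
    unfolding X[OF that, symmetric] Xs using that by (simp add: kron2_def st)
  \<comment> \<open>Pairing of the mixture with a product functional: \<open>\<alpha>\<close> acts
    on the output factor, \<open>\<beta>\<close> on the reference factor.\<close>
  have lin: "(\<Sum>i<2. \<Sum>j<2. \<Sum>p<2. \<Sum>q<2. \<beta> i j * \<alpha> p q * bmap N d (unit2 i j) $$ (p,q) / 2) =
     (\<Sum>k<m. w k * ((\<Sum>p<2. \<Sum>q<2. \<alpha> p q * bstate (s k) $$ (p,q)) * (\<Sum>i<2. \<Sum>j<2. \<beta> i j * bstate (t k) $$ (i,j))))"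
    for \<alpha> \<beta>
  proof -
    have "(\<Sum>i<2. \<Sum>j<2. \<Sum>p<2. \<Sum>q<2. \<beta> i j * \<alpha> p q * bmap N d (unit2 i j) $$ (p,q) / 2) =
      (\<Sum>i<2. \<Sum>j<2. \<Sum>p<2. \<Sum>q<2. \<beta> i j * \<alpha> p q * (\<Sum>k<m. w k * (bstate (s k) $$ (p,q) * bstate (t k) $$ (i,j))))"
      by (intro sum.cong refl) (simp add: eq[symmetric])
    also have "\<dots> = (\<Sum>k<m. w k * ((\<Sum>p<2. \<Sum>q<2. \<alpha> p q * bstate (s k) $$ (p,q)) * (\<Sum>i<2. \<Sum>j<2. \<beta> i j * bstate (t k) $$ (i,j))))"
      by (simp add: sum_less_2 sum_distrib_left sum.distrib distrib_left distrib_right mult_ac del: bstate_index)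
    finally show ?thesis .
  qed
  define id2 :: "nat \<Rightarrow> nat \<Rightarrow> complex" where "id2 p q = (if p = q then 1 else 0)" for p q
  \<comment> \<open>The second factor of the Choi matrix carries a transposition, which reflects \<open>\<sigma>\<^sub>y\<close>.\<close>
  define u where "u k = (\<chi> i. if i = 2 then - t k $ i else t k $ i)" for k
  have P: "(\<Sum>p<2. \<Sum>q<2. pauli (nat3 a) $$ (q,p) * bstate v $$ (p,q)) = complex_of_real (v $ a)" for a v
    using exhaust_3[of a] by (auto simp: sum_less_2 field_simps)
  have I: "(\<Sum>p<2. \<Sum>q<2. id2 p q * bstate v $$ (p,q)) = 1" for v
    by (simp add: sum_less_2 id2_def field_simps)
  have bcoord: "(\<Sum>p<2. \<Sum>q<2. pauli (nat3 a) $$ (q,p) * bmap N d A $$ (p,q)) = bcoord N d A a" for a A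
    using exhaust_3[of a] by (auto simp: sum_less_2 bmap_index sum_3 field_simps)
  note f_index = bmap_index bcoord_def cbloch_unit2 mtrace_unit2
  have "complex_of_real (d $ a) = complex_of_real (\<Sum>k<m. w k * s k $ a)" for a
  proof -
    have "(\<Sum>i<2. \<Sum>j<2. \<Sum>p<2. \<Sum>q<2. id2 i j * pauli (nat3 a) $$ (q,p) * bmap N d (unit2 i j) $$ (p,q) / 2)
        = complex_of_real (d $ a)"
      using exhaust_3[of a] by (auto simp: id2_def sum_less_2 f_index sum_3 field_simps)
    then show ?thesis
      unfolding lin P I by simp
  qed
  then have d: "d = (\<Sum>k<m. w k *\<^sub>R s k)"
    by (simp only: of_real_eq_iff Finite_Cartesian_Product.vec_eq_iff) simp
  \<comment> \<open>Identity on the output and a Pauli matrix on the reference: trace preservation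
    makes this pairing zero, which is the completeness of the measurement.\<close>
  have "0 = complex_of_real (\<Sum>k<m. w k * t k $ a)" for a
  proof -
    have "(\<Sum>i<2. \<Sum>j<2. \<Sum>p<2. \<Sum>q<2. pauli (nat3 a) $$ (j,i) * id2 p q * bmap N d (unit2 i j) $$ (p,q) / 2) = 0"
      using exhaust_3[of a] by (auto simp: id2_def sum_less_2 f_index sum_3 field_simps)
    then show ?thesis
      unfolding lin P I by simp
  qed
  then have t0: "(\<Sum>k<m. w k * t k $ a) = 0" for a
    by (metis of_real_eq_0_iff)
  have u0: "(\<Sum>k<m. w k *\<^sub>R u k) = 0"
  proof -
    have "(\<Sum>k<m. w k * u k $ i) = 0" for i
      using t0[of i] by (cases "i = 2") (simp_all add: u_def sum_negf)
    then show ?thesis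
      by (simp add: Finite_Cartesian_Product.vec_eq_iff)
  qed
  have "complex_of_real (N $ a $ b) = complex_of_real (\<Sum>k<m. w k * s k $ a * u k $ b)" for a b
  proof -
    have "(\<Sum>i<2. \<Sum>j<2. \<Sum>p<2. \<Sum>q<2. pauli (nat3 b) $$ (j,i) * pauli (nat3 a) $$ (q,p) *
        bmap N d (unit2 i j) $$ (p,q) / 2) = complex_of_real (if b = 2 then - N $ a $ b else N $ a $ b)"
      (is "?L = _")
    proof -
      have "?L = (\<Sum>i<2. \<Sum>j<2. pauli (nat3 b) $$ (j,i) * bcoord N d (unit2 i j) a / 2)"
        by (simp only: bcoord[symmetric] sum_distrib_left sum_divide_distrib mult.assoc)
      also have "\<dots> = complex_of_real (if b = 2 then - N $ a $ b else N $ a $ b)"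
        using exhaust_3[of b] by (auto simp: sum_less_2 bcoord_def cbloch_unit2 mtrace_unit2 sum_3 field_simps)
      finally show ?thesis .
    qed
    then show ?thesis
      unfolding lin P by (cases "b = 2") (auto simp: u_def sum_negf mult.assoc)
  qed
  then have N: "N $ a $ b = (\<Sum>k<m. w k * s k $ a * u k $ b)" for a b
    by (simp only: of_real_eq_iff)
  have Nx: "N *v x = (\<Sum>k<m. (w k * inner (u k) x) *\<^sub>R s k)" for x
    by (simp add: Finite_Cartesian_Product.vec_eq_iff matrix_vector_mult_def N inner_vec_def sum_3 sum_distrib_left
        sum_distrib_right sum.distrib algebra_simps)
  have un: "norm (u k) = norm (t k)" for k
    by (simp add: norm_eq_sqrt_inner inner_vec_def sum_3 u_def)
  show thesis
    by (rule that[of m w u s]) (use w st(1,2) d u0 Nx un in auto)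
qed

text \<open>On input \<open>p\<close> outcome \<open>k\<close> has probability
  \<open>w k * (1 + inner (u k) p)\<close>, and the mean of \<open>1 - inner (s k) q\<close> under
  these probabilities is zero. All terms are nonnegative, so each one vanishes.\<close>

lemma entanglement_breaking_rank_one:
  assumes EB: "entanglement_breaking (bmap N d)" and p: "norm p = 1" and q: "norm q = 1"
    and pq: "N *v p + d = q" and x: "inner p x = 0"
  shows "N *v x = 0"
proof -
  obtain m :: nat and w :: "nat \<Rightarrow> real" and u s :: "nat \<Rightarrow> real^3"
  where w: "\<forall>k<m. 0 \<le> w k" "(\<Sum>k<m. w k) = 1"
    and us: "\<forall>k<m. norm (u k) \<le> 1" "\<forall>k<m. norm (s k) \<le> 1"
    and u0: "(\<Sum>k<m. w k *\<^sub>R u k) = 0" and d: "d = (\<Sum>k<m. w k *\<^sub>R s k)"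
    and N': "\<forall>x. N *v x = (\<Sum>k<m. (w k * inner (u k) x) *\<^sub>R s k)"
    by (rule entanglement_breaking_measure_prepare[OF EB])
  note N = N'[rule_format] and w = w(1)[rule_format] w(2) and us = us[rule_format]
  have u0': "(\<Sum>k<m. w k * inner (u k) y) = 0" for y
    using arg_cong[OF u0, of "\<lambda>v. inner v y"] by (simp add: inner_sum_left)
  have qs: "q = (\<Sum>k<m. (w k * (1 + inner (u k) p)) *\<^sub>R s k)"
    unfolding pq[symmetric] N d by (simp add: distrib_left scaleR_add_left sum.distrib)
  have "inner q y = (\<Sum>k<m. w k * (1 + inner (u k) p) * inner (s k) y)" for y
    by (subst qs) (simp add: inner_sum_left)
  from this[of q] have s0: "(\<Sum>k<m. w k * (1 + inner (u k) p) * (1 - inner (s k) q)) = 0"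
    using q w(2) u0'[of p] by (simp add: norm_eq_1 right_diff_distrib sum_subtractf) (simp add: distrib_left sum.distrib)
  have cs: "\<bar>inner (u k) p\<bar> \<le> 1" "\<bar>inner (s k) q\<bar> \<le> 1" if "k < m" for k
    using us(1)[OF that] us(2)[OF that] Cauchy_Schwarz_ineq2[of "u k" p] Cauchy_Schwarz_ineq2[of "s k" q] p q by simp_all
  have nn: "\<forall>k\<in>{..<m}. 0 \<le> w k * (1 + inner (u k) p) * (1 - inner (s k) q)"
  proof
    fix k assume "k \<in> {..<m}"
    then have k: "k < m" by simp
    show "0 \<le> w k * (1 + inner (u k) p) * (1 - inner (s k) q)"
      using cs[OF k] w(1)[OF k] by (intro mult_nonneg_nonneg) auto
  qed
  have "\<forall>k\<in>{..<m}. w k * (1 + inner (u k) p) * (1 - inner (s k) q) = 0"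
    using s0 nn by (subst (asm) sum_nonneg_eq_0_iff) blast+
  then have z: "w k * (1 + inner (u k) p) * (1 - inner (s k) q) = 0" if "k < m" for k
    using that by blast
  \<comment> \<open>Either the outcome has no weight, or \<open>u k = - p\<close> is orthogonal to
    \<open>x\<close>, or \<open>s k = q\<close>. In every case \<open>s k\<close> may be replaced by
    \<open>q\<close>, and the sum then collapses to a multiple of the vanishing mean of
    \<open>u\<close>.\<close>
  have "(w k * inner (u k) x) *\<^sub>R s k = (w k * inner (u k) x) *\<^sub>R q" if k: "k < m" for k
  proof -
    consider "w k = 0" | "inner (u k) (-p) = 1" | "inner (s k) q = 1"
      using z[OF k] by auto
    then show ?thesis
    proof cases
      case 2
      then have "u k = - p"
        using us(1)[OF k] p by (simp add: unit_eq_if_inner_eq_1)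
      then show ?thesis using x by simp
    next
      case 3
      then show ?thesis
        using unit_eq_if_inner_eq_1[OF us(2)[OF k] q] by simp
    qed simp
  qed
  then have "N *v x = (\<Sum>k<m. (w k * inner (u k) x) *\<^sub>R q)"
    unfolding N by (intro sum.cong) auto
  also have "\<dots> = 0"
    using u0'[of x] by (simp flip: scaleR_left.sum)
  finally show ?thesis .
qed

subsection \<open>The Choi form of a Bloch map\<close>

text \<open>Matrix element of the Choi matrix between the product vectors \<open>x \<otimes> cnj y\<close> and \<open>x' \<otimes> cnj y'\<close>.\<close>
definition choi :: "real^3^3 \<Rightarrow> real^3 \<Rightarrow> (nat \<Rightarrow> complex) \<Rightarrow> (nat \<Rightarrow> complex) \<Rightarrow> (nat \<Rightarrow> complex) \<Rightarrow> (nat \<Rightarrow> complex) \<Rightarrow> complex" where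
  "choi N d x y x' y' = (sprod x x' * sprod y' y + (\<Sum>k\<in>UNIV. spauli x x' k *
     ((\<Sum>j\<in>UNIV. complex_of_real (N $ k $ j) * spauli y' y j) + complex_of_real (d $ k) * sprod y' y))) / 2"

lemma choi_eq_ext_id_bell:
  "choi N d x y x' y' = (\<Sum>p<2. \<Sum>i<2. \<Sum>q<2. \<Sum>j<2. cnj (x p) * y i * ext_id (bmap N d) 2 bell $$ (2*p+i, 2*q+j) * x' q * cnj (y' j))"
proof -
  have lin: "(\<Sum>i<2. \<Sum>j<2. c i j * ((f i j * S + (\<Sum>k\<in>UNIV. b i j k * P k)) / 2)) =
     ((\<Sum>i<2. \<Sum>j<2. c i j * f i j) * S + (\<Sum>k\<in>UNIV. (\<Sum>i<2. \<Sum>j<2. c i j * b i j k) * P k)) / 2"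
    for c f :: "nat \<Rightarrow> nat \<Rightarrow> complex" and b and P :: "3 \<Rightarrow> complex" and S
    by (simp add: sum_less_2 sum_3 field_simps)
  have e: "(\<Sum>i<2. \<Sum>j<2. y i * cnj (y' j) * bcoord N d (unit2 i j) k) =
     (\<Sum>l\<in>UNIV. complex_of_real (N $ k $ l) * spauli y' y l) + complex_of_real (d $ k) * sprod y' y" for k
    by (simp add: bcoord_def cbloch_unit2 mtrace_unit2 sum_less_2 sum_3 spauli_explicit sprod_explicit algebra_simps)
  have t: "(\<Sum>i<2. \<Sum>j<2. y i * cnj (y' j) * mtrace (unit2 i j)) = sprod y' y"
    by (simp add: mtrace_unit2 sum_less_2 sprod_explicit algebra_simps)
  have "(\<Sum>p<2. \<Sum>i<2. \<Sum>q<2. \<Sum>j<2. cnj (x p) * y i * ext_id (bmap N d) 2 bell $$ (2*p+i, 2*q+j) * x' q * cnj (y' j))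
    = (\<Sum>p<2. \<Sum>i<2. \<Sum>q<2. \<Sum>j<2. cnj (x p) * y i * bmap N d (unit2 i j) $$ (p,q) * x' q * cnj (y' j))"
    by (intro sum.cong refl) (simp add: ext_id_bell)
  also have "\<dots> = (\<Sum>i<2. \<Sum>j<2. y i * cnj (y' j) * (\<Sum>p<2. \<Sum>q<2. cnj (x p) * bmap N d (unit2 i j) $$ (p,q) * x' q))"
    by (simp add: sum_less_2 algebra_simps)
  also have "\<dots> = (\<Sum>i<2. \<Sum>j<2. y i * cnj (y' j) * ((mtrace (unit2 i j) * sprod x x' + (\<Sum>k\<in>UNIV. bcoord N d (unit2 i j) k * spauli x x' k)) / 2))"
  proof -
    have "(\<Sum>p<2. \<Sum>q<2. cnj (x p) * bmap N d A $$ (p,q) * x' q) =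
      (mtrace A * sprod x x' + (\<Sum>k\<in>UNIV. bcoord N d A k * spauli x x' k)) / 2" for A
      by (simp add: sum_less_2 bmap_index sum_3 sprod_explicit spauli_explicit) (simp add: field_simps)
    then show ?thesis by (simp only:)
  qed
  also have "\<dots> = ((\<Sum>i<2. \<Sum>j<2. y i * cnj (y' j) * mtrace (unit2 i j)) * sprod x x' +
      (\<Sum>k\<in>UNIV. (\<Sum>i<2. \<Sum>j<2. y i * cnj (y' j) * bcoord N d (unit2 i j) k) * spauli x x' k)) / 2"
    by (rule lin)
  also have "\<dots> = choi N d x y x' y'"
    unfolding e t choi_def by (simp add: mult.commute)
  finally show ?thesis by simp
qed

text \<open>The Choi matrix is evaluated at a linear combination of the product vectors of
  \<open>x l\<close> and the conjugate of \<open>y l\<close>.\<close>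

lemma completely_positive_choi:
  assumes "completely_positive (bmap N d)"
  shows "0 \<le> Re (\<Sum>l<m. \<Sum>l'<m. cnj (w l) * w l' * choi N d (x l) (y l) (x l') (y l'))"
proof -
  let ?C = "ext_id (bmap N d) 2 bell"
  have "psd 4 ?C"
    using assms[unfolded completely_positive_def, rule_format, of 2 bell] psd_bell by simp
  then have psd: "0 \<le> Re (\<Sum>r<4. \<Sum>s<4. cnj (v r) * ?C $$ (r,s) * v s)" for v
    by (simp add: psd_def del: Re_sum)
  define v where "v r = (\<Sum>l<m. w l * x l (r div 2) * cnj (y l (r mod 2)))" for r
  have s4: "(\<Sum>r<4. g r) = (\<Sum>p<2. \<Sum>i<2. g (2*p+i))" for g :: "nat \<Rightarrow> complex"
    by (simp add: sum_less_4 sum_less_2 numeral_3_eq_3 add.assoc)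
  have v: "v (2*p+i) = (\<Sum>l<m. w l * x l p * cnj (y l i))" if "i < 2" for p i
    using that by (simp add: v_def)
  have "(\<Sum>r<4. \<Sum>s<4. cnj (v r) * ?C $$ (r,s) * v s) =
     (\<Sum>p<2. \<Sum>i<2. \<Sum>q<2. \<Sum>j<2. cnj (\<Sum>l<m. w l * x l p * cnj (y l i)) * ?C $$ (2*p+i,2*q+j) * (\<Sum>l'<m. w l' * x l' q * cnj (y l' j)))"
    unfolding s4 by (intro sum.cong refl) (simp add: v)
  also have "\<dots> = (\<Sum>p<2. \<Sum>i<2. \<Sum>q<2. \<Sum>j<2. \<Sum>l<m. \<Sum>l'<m. cnj (w l) * w l' *
      (cnj (x l p) * y l i * ?C $$ (2*p+i,2*q+j) * x l' q * cnj (y l' j)))"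
    by (simp add: cnj_sum sum_distrib_left sum_distrib_right mult_ac)
  also have "\<dots> = (\<Sum>l<m. \<Sum>l'<m. cnj (w l) * w l' * choi N d (x l) (y l) (x l') (y l'))"
    unfolding choi_eq_ext_id_bell by (simp add: sum_less_2 sum.distrib distrib_left)
  finally show ?thesis
    using psd[of v] by simp
qed

lemma matrix_vector_mult_uminus [simp]: "N *v (- x) = - (N *v x)" for N :: "real^'n^'m"
  using matrix_vector_mult_scaleR[of N "-1" x] by simp

lemma spauli_cnj: "spauli y x k = cnj (spauli x y k)"
  using exhaust_3[of k] by (auto simp: spauli_explicit algebra_simps)

lemma sprod_cnj: "sprod y x = cnj (sprod x y)"
  by (simp add: sprod_explicit)

lemma choi_cnj: "choi N d x' y' x y = cnj (choi N d x y x' y')"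
  unfolding choi_def
  by (simp add: spauli_cnj[of x' x] spauli_cnj[of y y'] sprod_cnj[of x' x] sprod_cnj[of y y'] sum_3)

text \<open>Three vectors are what is left of a product basis of four once the one belonging to a
  zero diagonal entry is split off. Fixing the last coefficient to 1 leaves a quadratic polynomial
  in \<open>a\<close> and \<open>b\<close> to be minimised.\<close>

lemma choi_nonneg_3:
  assumes "completely_positive (bmap N d)"
  shows "0 \<le> (cmod a)\<^sup>2 * Re (choi N d x y x y) + (cmod b)\<^sup>2 * Re (choi N d x' y' x' y') + Re (choi N d x'' y'' x'' y'')
     + 2 * Re (cnj a * b * choi N d x y x' y') + 2 * Re (cnj a * choi N d x y x'' y'') + 2 * Re (cnj b * choi N d x' y' x'' y'')"
proof -
  have h: "Re (cnj w * v * choi N d x' y' x y) = Re (cnj v * w * choi N d x y x' y')" for w v x' y' x y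
    by (subst choi_cnj) (simp add: algebra_simps)
  show ?thesis
    using completely_positive_choi[OF assms, where m = 3 and w = "\<lambda>l. [a,b,1] ! l" and x = "\<lambda>l. [x,x',x''] ! l"
        and y = "\<lambda>l. [y,y',y''] ! l"]
      h[of b a x' y' x y] h[of 1 a x'' y'' x y] h[of 1 b x'' y'' x' y']
    unfolding cmod_power2 by (simp add: sum_less_3) (simp add: power2_eq_square algebra_simps)
qed

lemma choi_eval:
  assumes "\<And>k. spauli x x' k = Complex (z$k) (w$k)" "\<And>k. spauli y' y k = Complex (u$k) (v$k)"
    "sprod x x' = complex_of_real \<delta>" "sprod y' y = complex_of_real \<epsilon>"
  shows "choi N d x y x' y' = Complex ((\<delta> * \<epsilon> + inner z (N *v u) - inner w (N *v v) + \<epsilon> * inner z d) / 2)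
     ((inner z (N *v v) + inner w (N *v u) + \<epsilon> * inner w d) / 2)"
  unfolding choi_def assms
  by (simp add: complex_eq_iff inner_vec_def matrix_vector_mult_def sum_3) (simp add: algebra_simps)

section \<open>Orthonormal frames from pairs of antipodal spinors\<close>

text \<open>The antipodal spinor is the time reversal of \<open>x\<close>. The transition vector
  between the two is isotropic, and its real and imaginary parts complete \<open>p\<close> to a
  positively oriented frame. The zero imaginary parts are written out so that all four cases have
  the shape expected by \<open>choi_eval\<close>.\<close>

lemma spin_frame_exists:
  assumes "norm p = 1"
  obtains x y e1 e2 where "sprod x x = 1" "sprod y y = 1" "sprod x y = 0"
    "\<And>k. spauli x x k = Complex (p$k) ((0::real^3)$k)" "\<And>k. spauli y y k = Complex ((-p)$k) ((0::real^3)$k)"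
    "\<And>k. spauli x y k = Complex (e1$k) ((-e2)$k)" "\<And>k. spauli y x k = Complex (e1$k) (e2$k)"
    "norm e1 = 1" "norm e2 = 1" "inner e1 e2 = 0" "cross3 e1 e2 = p"
proof -
  obtain x where x: "spin_vec x = p" "sprod x x = 1"
    using spinor_exists[OF assms] by blast
  obtain a b c d where v: "x 0 = Complex a b" "x (Suc 0) = Complex c d"
    by (meson complex.exhaust)
  have n: "a * a + b * b + c * c + d * d = 1"
    using x(2) by (simp add: sprod_explicit complex_eq_iff v)
  define y where "y i = (if i = 0 then - cnj (x (Suc 0)) else cnj (x 0))" for i :: nat
  \<comment> \<open>The real part and the negated imaginary part of the transition vector
    \<open>spauli x y\<close>, expanded in the real coordinates of \<open>x\<close>.\<close>
  define e1 :: "real^3" where "e1 = vector [a*a - b*b - (c*c - d*d), - 2*(a*b + c*d), - 2*(a*c - b*d)]"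
  define e2 :: "real^3" where "e2 = vector [2*(a*b - c*d), (a*a - b*b) + (c*c - d*d), - 2*(a*d + b*c)]"
  have n2: "(a * a + b * b + c * c + d * d) * (a * a + b * b + c * c + d * d) = 1"
    by (simp add: n)
  have xy: "spauli x y k = Complex (e1$k) ((-e2)$k)" for k
    using exhaust_3[of k] by (auto simp: spauli_explicit y_def v complex_eq_iff e1_def e2_def algebra_simps)
  show thesis
  proof (rule that)
    show "sprod x x = 1" "sprod y y = 1" "sprod x y = 0"
      using x(2) by (simp_all add: sprod_explicit y_def algebra_simps)
    show "spauli x x k = Complex (p$k) ((0::real^3)$k)" for k
      by (simp add: spauli_self x complex_eq_iff)
    show "spauli y y k = Complex ((-p)$k) ((0::real^3)$k)" for k
      unfolding x(1)[symmetric] using exhaust_3[of k]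
      by (auto simp: spin_vec_index spauli_explicit y_def complex_eq_iff v)
    show "spauli x y k = Complex (e1$k) ((-e2)$k)" for k
      by (rule xy)
    show "spauli y x k = Complex (e1$k) (e2$k)" for k
      by (subst spauli_cnj) (simp add: xy complex_eq_iff)
    show "norm e1 = 1" "norm e2 = 1" "inner e1 e2 = 0"
      using n2 by (simp_all add: norm_eq_1 inner_vec_def sum_3 e1_def e2_def algebra_simps)
    \<comment> \<open>Homogenisation: the cross product is quartic in \<open>a\<close>,
      \<open>b\<close>, \<open>c\<close>, \<open>d\<close> but the Bloch vector only quadratic, so a
      factor equal to 1 is inserted.\<close>
    have s: "u = (a * a + b * b + c * c + d * d) * u" for u
      by (simp add: n)
    show "cross3 e1 e2 = p"
      unfolding x(1)[symmetric] Finite_Cartesian_Product.vec_eq_iff forall_3 spin_vec_index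
      by (intro conjI; subst s) (simp_all add: cross3_def e1_def e2_def spauli_explicit v algebra_simps)
  qed
qed

lemma frame_props:
  assumes "norm e1 = 1" "norm e2 = 1" "inner e1 e2 = 0" "cross3 e1 e2 = (p::real^3)"
  shows "norm p = 1" "inner e1 p = 0" "inner e2 p = 0" "cross3 p e1 = e2" "cross3 p e2 = - e1"
proof -
  show "norm p = 1"
    using norm_cross_dot[of e1 e2] assms by (simp add: power2_eq_1_iff) (smt (verit) norm_ge_zero)
  show "inner e1 p = 0" "inner e2 p = 0"
    unfolding assms(4)[symmetric] by (simp_all add: dot_cross_self)
  have "cross3 e1 p = - e2" "cross3 e2 p = e1"
    unfolding assms(4)[symmetric] Lagrange using assms by (simp_all add: norm_eq_1 inner_commute)
  then show "cross3 p e1 = e2" "cross3 p e2 = - e1"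
    using cross_skew[of p e1] cross_skew[of p e2] by simp_all
qed

text \<open>The remainder of the expansion is orthogonal to the frame, and by Lagrange's formula its
  cross product with \<open>p\<close> vanishes too. A vector both orthogonal and parallel to a unit
  vector is zero.\<close>

lemma frame_expand:
  assumes "norm e1 = 1" "norm e2 = 1" "inner e1 e2 = 0" "cross3 e1 e2 = (p::real^3)"
  shows "v = inner e1 v *\<^sub>R e1 + inner e2 v *\<^sub>R e2 + inner p v *\<^sub>R p"
proof -
  note fp = frame_props[OF assms]
  define w where "w = v - (inner e1 v *\<^sub>R e1 + inner e2 v *\<^sub>R e2 + inner p v *\<^sub>R p)"
  have "inner e2 e1 = 0" "inner p e1 = 0" "inner p e2 = 0"
    using assms(3) fp by (simp_all add: inner_commute)
  then have "inner e1 w = 0" "inner e2 w = 0" "inner p w = 0"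
    using assms fp by (simp_all add: w_def inner_diff_right inner_add_right norm_eq_1)
  then have w: "inner w e1 = 0" "inner w e2 = 0" "inner w p = 0"
    by (simp_all add: inner_commute)
  have "cross3 w p = 0"
    unfolding assms(4)[symmetric] Lagrange by (simp add: w)
  then have "w = 0"
    using norm_cross_dot[of w p] w fp(1) by simp
  then show ?thesis by (simp add: w_def)
qed

lemma frame_norm:
  assumes "norm e1 = 1" "norm e2 = 1" "inner e1 e2 = 0" "cross3 e1 e2 = (p::real^3)"
  shows "(norm v)\<^sup>2 = (inner e1 v)\<^sup>2 + (inner e2 v)\<^sup>2 + (inner p v)\<^sup>2"
proof -
  have "inner v v = inner v (inner e1 v *\<^sub>R e1 + inner e2 v *\<^sub>R e2 + inner p v *\<^sub>R p)"
    by (simp flip: frame_expand[OF assms])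
  then show ?thesis
    unfolding power2_norm_eq_inner by (simp add: inner_add_right inner_commute power2_eq_square)
qed

lemma vec_eq_frame:
  assumes "norm e1 = 1" "norm e2 = 1" "inner e1 e2 = 0" "cross3 e1 e2 = (p::real^3)"
    and "inner e1 v = inner e1 w" "inner e2 v = inner e2 w" "inner p v = inner p w"
  shows "v = w"
  using frame_expand[OF assms(1-4), of v] frame_expand[OF assms(1-4), of w] assms(5-) by simp

text \<open>A real-affine function bounded below has no slope; a large negative multiple of
  \<open>B\<close> would violate the bound. This is how a zero diagonal entry of the Choi matrix
  kills its row.\<close>

lemma linear_form_zero_if_nonneg:
  fixes B :: complex
  assumes "\<And>a. 0 \<le> c + 2 * Re (cnj a * B)"
  shows "B = 0"
proof (rule ccontr)
  assume "B \<noteq> 0"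
  define a where "a = complex_of_real (- (\<bar>c\<bar> + 1) / (cmod B)\<^sup>2) * B"
  have "cnj a * B = complex_of_real (- (\<bar>c\<bar> + 1) / (cmod B)\<^sup>2) * complex_of_real ((cmod B)\<^sup>2)"
    unfolding complex_norm_square a_def by (simp add: mult.commute)
  also have "\<dots> = complex_of_real (- (\<bar>c\<bar> + 1))"
    using \<open>B \<noteq> 0\<close> by (simp flip: of_real_mult del: of_real_minus)
  finally show False
    using assms[of a] by simp
qed

text \<open>In orthonormal frames adapted to \<open>p\<close> and \<open>q\<close> the Choi matrix has a vanishing diagonal entry.
  So its row vanishes as well, which makes \<open>N\<close> conformal from the plane orthogonal to \<open>p\<close> to the one
  orthogonal to \<open>q\<close>, and a \<open>3 \<times> 3\<close> block remains.\<close>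
lemma pure_to_pure_conformal:
  assumes CP: "completely_positive (bmap N d)" and p: "norm p = 1" and q: "norm q = 1"
    and pq: "N *v p + d = q"
  obtains \<mu> l where "\<forall>x. inner q (N *v x) = \<mu> * inner p x"
    "\<forall>x. inner p x = 0 \<longrightarrow> N *v (cross3 p x) = cross3 q (N *v x)"
    "\<forall>x. inner p x = 0 \<longrightarrow> (norm (N *v x))\<^sup>2 = l * (norm x)\<^sup>2"
    "0 \<le> l" "l \<le> \<mu>" "\<mu> \<le> 1" "(norm d)\<^sup>2 \<le> (1 - \<mu>) * (1 - l)"
proof -
  obtain Y Y' e1 e2 where Y: "sprod Y Y = 1" "sprod Y' Y' = 1" "sprod Y Y' = 0"
    "\<And>k. spauli Y Y k = Complex (p$k) ((0::real^3)$k)" "\<And>k. spauli Y' Y' k = Complex ((-p)$k) ((0::real^3)$k)"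
    "\<And>k. spauli Y Y' k = Complex (e1$k) ((-e2)$k)" "\<And>k. spauli Y' Y k = Complex (e1$k) (e2$k)"
    and e: "norm e1 = 1" "norm e2 = 1" "inner e1 e2 = 0" "cross3 e1 e2 = p"
    using spin_frame_exists[OF p] by metis
  obtain X X' f1 f2 where X: "sprod X X = 1" "sprod X' X' = 1" "sprod X X' = 0"
    "\<And>k. spauli X X k = Complex (q$k) ((0::real^3)$k)" "\<And>k. spauli X' X' k = Complex ((-q)$k) ((0::real^3)$k)"
    "\<And>k. spauli X X' k = Complex (f1$k) ((-f2)$k)" "\<And>k. spauli X' X k = Complex (f1$k) (f2$k)"
    and f: "norm f1 = 1" "norm f2 = 1" "inner f1 f2 = 0" "cross3 f1 f2 = q"
    using spin_frame_exists[OF q] by metis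
  note ep = frame_props[OF e] and fp = frame_props[OF f]
  have Y0: "sprod Y' Y = 0" and X0: "sprod X' X = 0"
    using Y(3) X(3) by (simp_all add: sprod_cnj[of Y' Y] sprod_cnj[of X' X])
  note S = X(4-7) Y(4-7)
  have P: "sprod X X = complex_of_real 1" "sprod X' X' = complex_of_real 1" "sprod X X' = complex_of_real 0"
    "sprod X' X = complex_of_real 0" "sprod Y Y = complex_of_real 1" "sprod Y' Y' = complex_of_real 1"
    "sprod Y Y' = complex_of_real 0" "sprod Y' Y = complex_of_real 0"
    by (simp_all add: X Y X0 Y0)
  define \<mu> where "\<mu> = inner q (N *v p)"
  have qd: "inner q d = 1 - \<mu>" "inner f1 d = - inner f1 (N *v p)" "inner f2 d = - inner f2 (N *v p)"
    using arg_cong[OF pq, of "inner q"] arg_cong[OF pq, of "inner f1"] arg_cong[OF pq, of "inner f2"] q fp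
    by (auto simp: \<mu>_def inner_add_right norm_eq_1)
  note ev = choi_eval[where N = N and d = d]
  have B00: "choi N d X Y X Y = 1"
    by (subst ev[OF S(1) S(5) P(1) P(5)]) (simp add: complex_eq_iff qd \<mu>_def[symmetric])
  have B11: "choi N d X Y' X Y' = 1 - \<mu>"
    by (subst ev[OF S(1) S(6) P(1) P(6)]) (simp add: complex_eq_iff qd \<mu>_def[symmetric])
  \<comment> \<open>The vanishing diagonal entry: the output on \<open>p\<close> is the pure state
    \<open>q\<close>, which is never found in the antipodal state.\<close>
  have B22: "choi N d X' Y X' Y = 0"
    by (subst ev[OF S(2) S(5) P(2) P(5)]) (simp add: complex_eq_iff qd \<mu>_def[symmetric])
  have B33: "choi N d X' Y' X' Y' = \<mu>"
    by (subst ev[OF S(2) S(6) P(2) P(6)]) (simp add: complex_eq_iff qd \<mu>_def[symmetric])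
  have "choi N d X' Y X' Y' = 0"
    using choi_nonneg_3[OF CP, of _ X' Y 0 X Y X' Y'] by (intro linear_form_zero_if_nonneg[of \<mu>]) (simp add: B22 B33)
  then have n3: "inner q (N *v e1) = 0" "inner q (N *v e2) = 0"
    by (subst (asm) ev[OF S(2) S(8) P(2) P(8)], simp add: complex_eq_iff)+
  \<comment> \<open>This entry of the killed row is the Cauchy-Riemann system for the map between
    the two planes.\<close>
  have "choi N d X' Y X Y' = 0"
    using choi_nonneg_3[OF CP, of _ X' Y 0 X Y X Y'] by (intro linear_form_zero_if_nonneg[of "1 - \<mu>"]) (simp add: B22 B11)
  then have n: "inner f2 (N *v e2) = inner f1 (N *v e1)" "inner f1 (N *v e2) = - inner f2 (N *v e1)"
    by (subst (asm) ev[OF S(4) S(8) P(4) P(8)], simp add: complex_eq_iff)+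
  define z where "z = Complex (inner f1 (N *v e1)) (- inner f2 (N *v e1))"
  define \<beta> where "\<beta> = Complex (- inner f1 (N *v p)) (inner f2 (N *v p))"
  have B01: "choi N d X Y X Y' = 0"
    by (subst ev[OF S(1) S(8) P(1) P(8)]) (simp add: complex_eq_iff n3)
  have B03: "choi N d X Y X' Y' = z"
    by (subst ev[OF S(3) S(8) P(3) P(8)]) (simp add: complex_eq_iff n z_def)
  have B13: "choi N d X Y' X' Y' = \<beta>"
    by (subst ev[OF S(3) S(6) P(3) P(6)]) (simp add: complex_eq_iff qd \<beta>_def)
  define l where "l = (cmod z)\<^sup>2"
  \<comment> \<open>The coefficient \<open>-z\<close> is optimal for the first vector. The multiple
    \<open>t\<close> of \<beta> stays free, since its optimum \<open>1 / (1 - \<mu>)\<close> is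
    undefined when \<open>\<mu> = 1\<close>.\<close>
  have form: "0 \<le> \<mu> - l + t * t * (cmod \<beta>)\<^sup>2 * (1 - \<mu>) - 2 * t * (cmod \<beta>)\<^sup>2" for t
  proof -
    have 1: "Re (cnj (- z) * z) = - (cmod z)\<^sup>2" "Re (cnj (complex_of_real (- t) * \<beta>) * \<beta>) = - t * (cmod \<beta>)\<^sup>2"
      by (simp_all add: cmod_power2) (simp_all add: power2_eq_square algebra_simps)
    show ?thesis
      using choi_nonneg_3[OF CP, of "-z" X Y "complex_of_real (- t) * \<beta>" X Y' X' Y']
      unfolding B00 B11 B33 B01 B03 B13 1 by (simp add: l_def norm_mult power_mult_distrib power2_eq_square[of t] algebra_simps)
  qed
  have mu1: "0 \<le> 1 - \<mu>"
    using choi_nonneg_3[OF CP, of 0 X Y 0 X Y X Y'] by (simp add: B11)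
  \<comment> \<open>For \<open>\<mu> = 1\<close> the form is linear in \<open>t\<close>, which
    forces \<beta> to vanish; otherwise the optimal \<open>t\<close> gives the Schur complement
    bound.\<close>
  have \<beta>: "(cmod \<beta>)\<^sup>2 \<le> (1 - \<mu>) * (\<mu> - l)"
  proof (cases "\<mu> = 1")
    case True
    have "(cmod \<beta>)\<^sup>2 = 0"
    proof (rule ccontr)
      assume "(cmod \<beta>)\<^sup>2 \<noteq> 0"
      then have "l \<le> - 1"
        using form[of "1 / (cmod \<beta>)\<^sup>2"] True by simp
      moreover have "0 \<le> l" by (simp add: l_def)
      ultimately show False by simp
    qed
    then show ?thesis using True by simp
  next
    case False
    with mu1 have "0 < 1 - \<mu>" by simp
    moreover from this have "0 \<le> \<mu> - l - (cmod \<beta>)\<^sup>2 / (1 - \<mu>)"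
      using form[of "1 / (1 - \<mu>)"] by simp
    ultimately show ?thesis
      by (simp add: field_simps)
  qed
  have Nqx: "inner q (N *v x) = \<mu> * inner p x" for x
  proof -
    have "N *v x = inner e1 x *\<^sub>R (N *v e1) + inner e2 x *\<^sub>R (N *v e2) + inner p x *\<^sub>R (N *v p)"
      by (subst frame_expand[OF e, of x]) (simp only: matrix_vector_right_distrib matrix_vector_mult_scaleR)
    then show ?thesis
      by (simp add: inner_add_right n3 \<mu>_def)
  qed
  have Nx: "inner f1 (N *v x) = inner e1 x * inner f1 (N *v e1) - inner e2 x * inner f2 (N *v e1)"
    "inner f2 (N *v x) = inner e1 x * inner f2 (N *v e1) + inner e2 x * inner f1 (N *v e1)"
    if "inner p x = 0" for x
  proof -
    have *: "N *v x = inner e1 x *\<^sub>R (N *v e1) + inner e2 x *\<^sub>R (N *v e2)"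
      using that by (subst frame_expand[OF e, of x]) (simp add: matrix_vector_right_distrib matrix_vector_mult_scaleR)
    show "inner f1 (N *v x) = inner e1 x * inner f1 (N *v e1) - inner e2 x * inner f2 (N *v e1)"
      "inner f2 (N *v x) = inner e1 x * inner f2 (N *v e1) + inner e2 x * inner f1 (N *v e1)"
      unfolding * by (simp_all add: inner_add_right n)
  qed
  show thesis
  proof (rule that[of \<mu> l]; (intro allI impI)?)
    show "inner q (N *v x) = \<mu> * inner p x" for x
      by (rule Nqx)
    fix x assume x: "inner p x = 0"
    have px: "inner p (cross3 p x) = 0" "inner e1 (cross3 p x) = - inner e2 x" "inner e2 (cross3 p x) = inner e1 x"
      using cross_triple[of e1 p x] cross_triple[of e2 p x] ep
      by (simp_all add: dot_cross_self inner_commute cross_skew[of e1 p] cross_skew[of e2 p] cross_triple)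
    have qx: "inner f1 (cross3 q y) = - inner f2 y" "inner f2 (cross3 q y) = inner f1 y" for y
      using cross_triple[of f1 q y] cross_triple[of f2 q y] fp
      by (simp_all add: dot_cross_self inner_commute cross_skew[of f1 q] cross_skew[of f2 q] cross_triple)
    show "N *v (cross3 p x) = cross3 q (N *v x)"
      by (rule vec_eq_frame[OF f]) (simp_all add: Nx x px qx Nqx dot_cross_self)
    show "(norm (N *v x))\<^sup>2 = l * (norm x)\<^sup>2"
      unfolding frame_norm[OF f, of "N *v x"] frame_norm[OF e, of x] Nx[OF x] Nqx x
      by (simp add: l_def cmod_power2 z_def) (simp add: power2_eq_square algebra_simps)
  next
    show "0 \<le> l" by (simp add: l_def)
    show "\<mu> \<le> 1" using mu1 by simp
    show "l \<le> \<mu>" using form[of 0] by simp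
    \<comment> \<open>The shift has component \<open>1 - \<mu>\<close> along \<open>q\<close>, and
      its part orthogonal to \<open>q\<close> has length \<open>cmod \<beta>\<close>.\<close>
    have "(norm d)\<^sup>2 = (cmod \<beta>)\<^sup>2 + (1 - \<mu>)\<^sup>2"
      unfolding frame_norm[OF f, of d] qd by (simp add: \<beta>_def cmod_power2)
    also have "\<dots> \<le> (1 - \<mu>) * (\<mu> - l) + (1 - \<mu>)\<^sup>2"
      using \<beta> by simp
    also have "\<dots> = (1 - \<mu>) * (1 - l)"
      by (simp add: power2_eq_square algebra_simps)
    finally show "(norm d)\<^sup>2 \<le> (1 - \<mu>) * (1 - l)" .
  qed
qed

section \<open>Action of a channel on the Bloch ball\<close>

text \<open>A point of the ball lies on a diameter, so it is a convex combination of two antipodal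
  unit vectors.\<close>

lemma affine_ball_le:
  fixes N :: "real^3^3"
  assumes "\<And>p. norm p = 1 \<Longrightarrow> norm (N *v p + d) \<le> t" "norm x \<le> 1"
  shows "norm (N *v x + d) \<le> t"
proof -
  obtain u r where u: "norm u = 1" "x = r *\<^sub>R u" "0 \<le> r" "r \<le> 1"
  proof (cases "x = 0")
    case True
    then show thesis
      using that[of "axis 1 1" 0] by simp
  next
    case False
    then show thesis
      using that[of "x /\<^sub>R norm x" "norm x"] assms(2) by simp
  qed
  have "N *v x + d = ((1 + r) / 2) *\<^sub>R (N *v u + d) + ((1 - r) / 2) *\<^sub>R (N *v (- u) + d)"
    by (simp add: u(2) matrix_vector_mult_scaleR Finite_Cartesian_Product.vec_eq_iff field_simps)
  also have "norm \<dots> \<le> ((1 + r) / 2) * norm (N *v u + d) + ((1 - r) / 2) * norm (N *v (- u) + d)"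
    using u by (intro norm_triangle_le) simp
  also have "\<dots> \<le> ((1 + r) / 2) * t + ((1 - r) / 2) * t"
    using u assms(1)[of u] assms(1)[of "- u"] by (intro add_mono mult_left_mono) auto
  also have "\<dots> = t"
    by (simp add: field_simps)
  finally show ?thesis .
qed

text \<open>Positivity on a single product vector gives
  \<open>0 \<le> 1 + inner q (N *v p + d)\<close> for all unit \<open>q\<close>; the direction
  opposite to the output bounds its length.\<close>

lemma channel_ball:
  assumes CP: "completely_positive (bmap N d)" and x: "norm x \<le> 1"
  shows "norm (N *v x + d) \<le> 1"
proof -
  have unit: "0 \<le> 1 + inner q (N *v p) + inner q d" if p: "norm p = 1" and q: "norm q = 1" for p q
  proof -
    obtain Y where Y: "spin_vec Y = p" "sprod Y Y = 1"
      using spinor_exists[OF p] by blast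
    obtain X where X: "spin_vec X = q" "sprod X X = 1"
      using spinor_exists[OF q] by blast
    have S: "spauli Y Y k = Complex (p$k) ((0::real^3)$k)" "spauli X X k = Complex (q$k) ((0::real^3)$k)" for k
      by (simp_all add: spauli_self X Y complex_eq_iff)
    have P: "sprod X X = complex_of_real 1" "sprod Y Y = complex_of_real 1"
      by (simp_all add: X Y)
    show ?thesis
      using choi_nonneg_3[OF CP, of 0 X Y 0 X Y X Y] choi_eval[OF S(2) S(1) P, of N d] by simp
  qed
  have "norm (N *v p + d) \<le> 1" if p: "norm p = 1" for p
  proof (rule ccontr)
    assume n: "\<not> norm (N *v p + d) \<le> 1"
    define v where "v = N *v p + d"
    have v: "norm v > 1" "v \<noteq> 0"
      using n by (auto simp: v_def)
    have "norm (- (v /\<^sub>R norm v)) = 1"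
      using v by simp
    from unit[OF p this] have "0 \<le> 1 - inner v v / norm v"
      by (simp add: v_def inner_add_right divide_inverse algebra_simps)
    then show False
      using v by (simp add: power2_norm_eq_inner[symmetric] power2_eq_square)
  qed
  then show ?thesis
    using affine_ball_le x by blast
qed

subsection \<open>Pure outputs\<close>

lemma inner_neq_1_if_unit_neq:
  fixes a b :: "'a::real_inner"
  assumes "norm a = 1" "norm b = 1" "a \<noteq> b"
  shows "inner a b \<noteq> 1"
  using unit_eq_if_inner_eq_1[of a b] assms by auto

lemma exists_orthogonal_unit: obtains e :: "real^3" where "norm e = 1" "inner p e = 0"
proof -
  have "2 \<le> DIM(real^3)" by simp
  then obtain y :: "real^3" where "y \<noteq> 0" "Linear_Algebra.orthogonal p y"
    using orthogonal_to_vector_exists by metis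
  then have y: "y \<noteq> 0" "inner p y = 0"
    by (simp_all add: Linear_Algebra.orthogonal_def)
  show thesis
  proof (rule that)
    show "norm (y /\<^sub>R norm y) = 1" "inner p (y /\<^sub>R norm y) = 0"
      using y by simp_all
  qed
qed

lemma frame_of_two:
  assumes "norm p = 1" "norm e = 1" "inner p e = 0"
  shows "norm (cross3 p e) = 1" "inner e (cross3 p e) = 0" "cross3 e (cross3 p e) = p"
  using norm_cross_dot[of p e] assms
  by (simp_all add: Lagrange dot_cross_self norm_eq_1 inner_commute power2_eq_1_iff) (smt (verit) norm_ge_zero)

lemma polar_pair:
  assumes "a\<^sup>2 + b\<^sup>2 = lam\<^sup>2" "lam \<noteq> (0::real)"
  obtains \<theta> where "a = lam * cos \<theta>" "b = lam * sin \<theta>"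
proof -
  have "(a / lam)\<^sup>2 + (b / lam)\<^sup>2 = 1"
    using assms by (simp add: power_divide add_divide_distrib[symmetric])
  then obtain \<theta> where "a / lam = cos \<theta>" "b / lam = sin \<theta>"
    using sincos_total_2pi by metis
  then show thesis
    using that[of \<theta>] assms(2) by (simp add: field_simps)
qed

text \<open>The pure image of \<open>y\<close> is the midpoint of the images of \<open>y + u\<close>
  and \<open>y - u\<close>, which lie in the ball. By the parallelogram law a unit vector is an
  extreme point, so \<open>N\<close> kills every small \<open>u\<close> and hence everything. The
  second conclusion presents the constant value as a fixed pure state.\<close>

lemma channel_constant_if_interior_to_pure:
  assumes CP: "completely_positive (bmap N d)" and y: "norm y < 1" "norm (N *v y + d) = 1"
  shows "norm d = 1" "N *v d + d = d"
proof -
  define r where "r = 1 - norm y"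
  have r: "r > 0" using y by (simp add: r_def)
  have "N *v x = 0" for x
  proof -
    define u where "u = (r / (norm x + 1)) *\<^sub>R x"
    have c: "r / (norm x + 1) > 0"
      using r by (simp add: add_nonneg_pos)
    have "norm u = (r / (norm x + 1)) * norm x"
      by (simp only: u_def norm_scaleR abs_of_pos[OF c])
    also have "\<dots> \<le> (r / (norm x + 1)) * (norm x + 1)"
      using c by (intro mult_left_mono) auto
    also have "\<dots> = r"
      using norm_ge_zero[of x] by (simp add: add_nonneg_eq_0_iff)
    finally have "norm u \<le> r" .
    then have "norm (y + u) \<le> 1" "norm (y - u) \<le> 1"
      using norm_triangle_ineq[of y u] norm_triangle_ineq4[of y u] by (auto simp: r_def)
    then have "norm ((N *v y + d) + N *v u) \<le> 1" "norm ((N *v y + d) - N *v u) \<le> 1"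
      using channel_ball[OF CP, of "y + u"] channel_ball[OF CP, of "y - u"]
      by (simp_all add: matrix_vector_right_distrib matrix_vector_mult_diff_distrib algebra_simps)
    then have "(norm ((N *v y + d) + N *v u))\<^sup>2 \<le> 1" "(norm ((N *v y + d) - N *v u))\<^sup>2 \<le> 1"
      by (simp_all add: abs_square_le_1)
    moreover have "(norm (a + b))\<^sup>2 + (norm (a - b))\<^sup>2 = 2 * (norm a)\<^sup>2 + 2 * (norm b)\<^sup>2" for a b :: "real^3"
      by (simp add: power2_norm_eq_inner inner_add_left inner_add_right inner_diff_left inner_diff_right)
    ultimately have "(norm (N *v u))\<^sup>2 \<le> 0"
      using y(2) by (smt (verit) one_power2)
    then have "N *v u = 0" by simp
    then have "(r / (norm x + 1)) *\<^sub>R (N *v x) = 0"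
      by (simp only: u_def matrix_vector_mult_scaleR)
    then show ?thesis
      using c by (metis less_irrefl scaleR_eq_0_iff)
  qed
  then show "norm d = 1" "N *v d + d = d"
    using y(2) by simp_all
qed

lemma matrix_mult_diff_ldistrib: "A ** (B - C) = A ** B - A ** C" for A B C :: "real^'n^'n"
  by (simp add: matrix_matrix_mult_def Finite_Cartesian_Product.vec_eq_iff right_diff_distrib sum_subtractf)

text \<open>Euler's theorem: \<open>det (A - 1) = det (A (1 - A^T)) = det (1 - A)\<close>, and in
  odd dimension the last determinant is \<open>- det (A - 1)\<close>, so 1 is an eigenvalue.\<close>

lemma rotation_fixed_vector:
  fixes A :: "real^3^3"
  assumes "orthogonal_matrix A" "Determinants.det A = 1"
  obtains x where "norm x = 1" "A *v x = x"
proof -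
  have A: "A ** transpose A = Finite_Cartesian_Product.mat 1"
    using assms(1) by (simp add: orthogonal_matrix_def)
  have "Determinants.det (A - Finite_Cartesian_Product.mat 1) = Determinants.det (A ** transpose (Finite_Cartesian_Product.mat 1 - A))"
  proof -
    have "transpose (Finite_Cartesian_Product.mat 1 - A) = Finite_Cartesian_Product.mat 1 - transpose A"
      by (auto simp: Finite_Cartesian_Product.vec_eq_iff Finite_Cartesian_Product.transpose_def Finite_Cartesian_Product.mat_def)
    then show ?thesis
      by (simp add: matrix_mult_diff_ldistrib A)
  qed
  also have "\<dots> = Determinants.det (Finite_Cartesian_Product.mat 1 - A)"
    by (simp only: det_mul assms(2) Determinants.det_transpose mult_1)
  also have "\<dots> = - Determinants.det (A - Finite_Cartesian_Product.mat 1)"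
    by (simp add: det_3 algebra_simps)
  finally have "Determinants.det (A - Finite_Cartesian_Product.mat 1) = 0"
    by simp
  then obtain x where x: "x \<noteq> 0" "(A - Finite_Cartesian_Product.mat 1) *v x = 0"
    using invertible_det_nz invertible_left_inverse matrix_left_invertible_ker by metis
  then have "A *v x = x"
    by (simp add: matrix_vector_mult_diff_rdistrib)
  then show thesis
    using x(1) by (intro that[of "x /\<^sub>R norm x"]) (auto simp: matrix_vector_mult_scaleR)
qed

text \<open>Writing \<open>D = |d|\<^sup>2\<close>, the squared length of the image of \<open>y - (p1 \<bullet> y) p1\<close> for \<open>y = p0\<close> and \<open>y = p2\<close> gives the
  same affine equation for \<open>p1 \<bullet> p0\<close> and \<open>p1 \<bullet> p2\<close>; both of its possible solutions make \<open>N\<close> a rotation.\<close>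
lemma three_pure_outputs_fixed:
  assumes CP: "completely_positive (bmap N d)"
    and p: "norm p0 = 1" "norm p1 = 1" "norm p2 = 1" "norm p3 = 1"
    and step: "N *v p0 + d = p1" "N *v p1 + d = p2" "N *v p2 + d = p3"
    and ne: "p0 \<noteq> p1" "p1 \<noteq> p2" "p0 \<noteq> p2"
  obtains x where "norm x = 1" "N *v x + d = x"
proof -
  obtain \<mu>0 where m0: "\<forall>x. inner p1 (N *v x) = \<mu>0 * inner p0 x"
    by (rule pure_to_pure_conformal[OF CP p(1,2) step(1)])
  obtain \<mu>2 where m2: "\<forall>x. inner p3 (N *v x) = \<mu>2 * inner p2 x"
    by (rule pure_to_pure_conformal[OF CP p(3,4) step(3)])
  obtain \<mu> l where m1: "\<forall>x. inner p2 (N *v x) = \<mu> * inner p1 x"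
    and cr: "\<forall>x. inner p1 x = 0 \<longrightarrow> N *v (cross3 p1 x) = cross3 p2 (N *v x)"
    and nr: "\<forall>x. inner p1 x = 0 \<longrightarrow> (norm (N *v x))\<^sup>2 = l * (norm x)\<^sup>2"
    and l: "0 \<le> l" "l \<le> \<mu>" "\<mu> \<le> 1" "(norm d)\<^sup>2 \<le> (1 - \<mu>) * (1 - l)"
    by (rule pure_to_pure_conformal[OF CP p(2,3) step(2)])
  have u: "inner p0 p0 = 1" "inner p1 p1 = 1" "inner p2 p2 = 1" "inner p3 p3 = 1"
    using p by (simp_all add: norm_eq_1)
  define D where "D = inner d d"
  define t where "t = inner p1 p0"
  define s where "s = inner p1 p2"
  have t1: "t \<noteq> 1" and s1: "s \<noteq> 1"
    using inner_neq_1_if_unit_neq[of p1 p0] inner_neq_1_if_unit_neq[of p1 p2] p ne by (auto simp: t_def s_def)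
  have d0: "inner p1 d = 1 - \<mu>0"
    using m0[rule_format, of p0] u arg_cong[OF step(1), of "inner p1"] by (simp add: inner_add_right)
  have d1: "inner p2 d = 1 - \<mu>"
    using m1[rule_format, of p1] u arg_cong[OF step(2), of "inner p2"] by (simp add: inner_add_right)
  have d2: "inner p3 d = 1 - \<mu>2"
    using m2[rule_format, of p2] u arg_cong[OF step(3), of "inner p3"] by (simp add: inner_add_right)
  have p12: "inner p1 p2 = \<mu>0 * t + (1 - \<mu>0)" "inner p2 p1 = \<mu> * t + (1 - \<mu>)"
    using m0[rule_format, of p1] arg_cong[OF step(2), of "inner p1"] m1[rule_format, of p0] arg_cong[OF step(1), of "inner p2"]
    by (simp_all add: inner_add_right d0 d1 t_def inner_commute[of p0 p1])
  have p23: "inner p2 p3 = \<mu> * s + (1 - \<mu>)" "inner p3 p2 = \<mu>2 * s + (1 - \<mu>2)"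
    using m1[rule_format, of p2] arg_cong[OF step(3), of "inner p2"] m2[rule_format, of p1] arg_cong[OF step(2), of "inner p3"]
    by (simp_all add: inner_add_right d1 d2 s_def inner_commute[of p2 p1])
  have st: "s = \<mu> * t + (1 - \<mu>)"
    using p12(2) by (simp add: s_def inner_commute[of p2 p1])
  \<comment> \<open>The number \<open>inner p1 p2\<close> is computed twice, by pairing the second
    step with \<open>p1\<close> and the first step with \<open>p2\<close>. The same is then done one
    step later with \<open>p2\<close> and \<open>p3\<close>.\<close>
  have "(\<mu>0 - \<mu>) * (t - 1) = 0"
    using p12 by (simp add: inner_commute[of p2 p1] algebra_simps)
  then have \<mu>0: "\<mu>0 = \<mu>" using t1 by simp
  have "(\<mu>2 - \<mu>) * (s - 1) = 0"
    using p23 by (simp add: inner_commute[of p3 p2] algebra_simps)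
  then have \<mu>2: "\<mu>2 = \<mu>" using s1 by simp
  have eqn: "(D - 1) * (1 - c) + 2 * \<mu> = l * (1 + c)"
    if c: "c = inner p1 y" "c \<noteq> 1" and z: "N *v y + d = z" "inner y y = 1" "inner z z = 1"
      "inner p2 z = \<mu> * c + (1 - \<mu>)" "inner z d = 1 - \<mu>" for c y z
  proof -
    define x where "x = y - c *\<^sub>R p1"
    have x: "inner p1 x = 0" "(norm x)\<^sup>2 = 1 - c * c"
      unfolding power2_norm_eq_inner using u z(2)
      by (simp_all add: x_def inner_diff_left inner_diff_right c(1) inner_commute)
    have Nx: "N *v x = z - c *\<^sub>R p2 - (1 - c) *\<^sub>R d"
      unfolding x_def step(2)[symmetric] z(1)[symmetric]
      by (simp add: matrix_vector_mult_diff_distrib matrix_vector_mult_scaleR algebra_simps)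
    have "(norm (N *v x))\<^sup>2 = 1 + c * c + (1 - c) * (1 - c) * D - 2 * c * (\<mu> * c + (1 - \<mu>))
        - 2 * (1 - c) * (1 - \<mu>) + 2 * c * (1 - c) * (1 - \<mu>)"
    proof -
      have "inner z p2 = \<mu> * c + (1 - \<mu>)" "inner d z = 1 - \<mu>" "inner d p2 = 1 - \<mu>"
        using z(4,5) d1 by (simp_all add: inner_commute)
      then show ?thesis
        unfolding power2_norm_eq_inner Nx
        by (simp add: inner_diff_left inner_diff_right u z(3-5) d1 D_def[symmetric]) (simp add: algebra_simps)
    qed
    moreover have "(norm (N *v x))\<^sup>2 = l * (1 - c * c)"
      using nr x by simp
    ultimately have "(1 - c) * ((D - 1) * (1 - c) + 2 * \<mu> - l * (1 + c)) = 0"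
      by (simp add: algebra_simps)
    then show ?thesis using c(2) by simp
  qed
  have e0: "(D - 1) * (1 - t) + 2 * \<mu> = l * (1 + t)"
    by (rule eqn[OF t_def t1 step(1)]) (use u p12 d0 \<mu>0 in auto)
  have e2: "(D - 1) * (1 - s) + 2 * \<mu> = l * (1 + s)"
    by (rule eqn[OF s_def s1 step(3)]) (use u p23 d2 \<mu>2 in auto)
  have D: "0 \<le> D" "D \<le> (1 - \<mu>) * (1 - l)"
    using l(4) by (simp_all add: D_def power2_norm_eq_inner)
  have key: "\<mu> = 1 \<and> l = 1"
  proof (cases "t = s")
    case True
    have "(1 - \<mu>) * (1 - t) = 0"
      using st True by (simp add: algebra_simps)
    then have \<mu>: "\<mu> = 1" using t1 by simp
    have "D = 0"
      using D \<mu> by simp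
    then have "1 + t = l * (1 + t)"
      using e0 \<mu> by simp
    then have "(1 - l) * (1 + t) = 0"
      by (simp add: left_diff_distrib)
    \<comment> \<open>Otherwise \<open>p0\<close> and \<open>p2\<close> would both be the antipode
      of \<open>p1\<close>.\<close>
    moreover have "1 + t \<noteq> 0"
    proof
      assume "1 + t = 0"
      then have "inner p1 (- p0) = 1" "inner p1 (- p2) = 1"
        using True by (simp_all add: t_def s_def)
      then have "p1 = - p0" "p1 = - p2"
        using unit_eq_if_inner_eq_1[of p1 "- p0"] unit_eq_if_inner_eq_1[of p1 "- p2"] p by auto
      then show False using ne(3) by simp
    qed
    ultimately show ?thesis using \<mu> by simp
  next
    case False
    \<comment> \<open>The difference of the two copies of the affine equation isolates its
      slope.\<close>
    have "(1 - D - l) * (t - s) = ((D - 1) * (1 - t) + 2 * \<mu> - l * (1 + t)) - ((D - 1) * (1 - s) + 2 * \<mu> - l * (1 + s))"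
      by (simp add: algebra_simps)
    also have "\<dots> = 0"
      by (simp add: e0 e2)
    finally have lD: "l = 1 - D" using False by simp
    have "2 * \<mu> = (1 - D) * (1 + t) - (D - 1) * (1 - t)"
      using e0 lD by simp
    also have "\<dots> = 2 * (1 - D)"
      by (simp add: algebra_simps)
    finally have \<mu>D: "\<mu> = 1 - D" by simp
    \<comment> \<open>With \<open>l = \<mu> = 1 - D\<close> the bound on the shift reads
      \<open>D \<le> D * D\<close>, which leaves only \<open>D = 0\<close> once
      \<open>D < 1\<close>. The value \<open>\<mu> = 0\<close> is excluded because it would give
      \<open>s = 1\<close>.\<close>
    have "\<mu> \<noteq> 0"
      using st s1 by auto
    then have "D < 1" using lD \<mu>D l(1) by simp
    moreover have "D * (1 - D) \<le> 0"
      using D(2) lD \<mu>D by (simp add: algebra_simps)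
    ultimately have "D = 0"
      using D(1) by (auto simp: mult_le_0_iff)
    then show ?thesis using lD \<mu>D by simp
  qed
  have d: "d = 0"
    using key l(4) by simp
  have iso: "norm (N *v x) = norm x" for x
  proof -
    define y where "y = x - inner p1 x *\<^sub>R p1"
    have y: "inner p1 y = 0" "x = y + inner p1 x *\<^sub>R p1"
      using u by (simp_all add: y_def inner_diff_right)
    have "N *v (y + inner p1 x *\<^sub>R p1) = N *v y + inner p1 x *\<^sub>R p2"
      by (simp add: matrix_vector_right_distrib matrix_vector_mult_scaleR step(2)[symmetric] d)
    then have Nx: "N *v x = N *v y + inner p1 x *\<^sub>R p2"
      by (simp only: y(2)[symmetric])
    have "(norm (N *v x))\<^sup>2 = (norm (N *v y))\<^sup>2 + (inner p1 x)\<^sup>2"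
      unfolding power2_norm_eq_inner Nx using m1[rule_format, of y] y(1) u
      by (simp add: inner_add_left inner_add_right inner_commute power2_eq_square)
    also have "\<dots> = (norm y)\<^sup>2 + (inner p1 x)\<^sup>2"
      using nr y key by simp
    also have "\<dots> = (norm x)\<^sup>2"
      unfolding power2_norm_eq_inner using u
      by (simp add: y_def inner_diff_left inner_diff_right inner_commute power2_eq_square)
    finally show ?thesis by simp
  qed
  have ot: "orthogonal_transformation ((*v) N)"
    by (simp add: orthogonal_transformation iso)
  then have om: "orthogonal_matrix N"
    by (simp add: orthogonal_transformation_matrix)
  obtain e where e: "norm e = 1" "inner p1 e = 0"
    using exists_orthogonal_unit by blast
  \<comment> \<open>An orthogonal matrix respects cross products up to its determinant. Conformality
    has no such factor, so the determinant is 1.\<close>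
  have "cross3 p2 (N *v e) = Determinants.det N *\<^sub>R (N *v cross3 p1 e)"
    using cross_orthogonal_matrix[OF om, of p1 e] step(2) d by simp
  with cr[rule_format, OF e(2)] have "N *v cross3 p1 e = Determinants.det N *\<^sub>R (N *v cross3 p1 e)"
    by (rule trans)
  moreover have "N *v cross3 p1 e \<noteq> 0"
    using iso[of "cross3 p1 e"] frame_of_two(1)[OF p(2) e] by auto
  moreover have "c = 1" if "v = c *\<^sub>R v" "v \<noteq> 0" for c and v :: "real^3"
  proof -
    have "(1 - c) *\<^sub>R v = v - c *\<^sub>R v"
      by (simp add: scaleR_left_diff_distrib)
    also have "\<dots> = 0"
      using that(1) by (simp only: right_minus_eq)
    finally show ?thesis
      using that(2) by simp
  qed
  ultimately have "Determinants.det N = 1"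
    by blast
  from rotation_fixed_vector[OF om this] show thesis
    using that d by auto
qed

section \<open>Normal forms at a pure fixed state and at a swapped pure pair\<close>

text \<open>With equal axes the planar block commutes with the quarter turn about \<open>p\<close>,
  so it is a scaled rotation. Choosing \<open>e1\<close> along the tangential part of
  \<open>N *v p\<close> leaves a single entry \<alpha>, and fixedness of \<open>p\<close> puts its
  negative into the shift. The bound on the shift, less the contribution of its \<open>p\<close>
  component, becomes the bound on \<alpha>.\<close>

lemma pure_fixed_normal_form:
  assumes CP: "completely_positive (bmap N d)" and p: "norm p = 1" and fix_p: "N *v p + d = p"
    and nz: "\<not> (\<forall>x. inner p x = 0 \<longrightarrow> N *v x = 0)"
  obtains e1 e2 \<theta> lam \<mu> \<alpha> where "norm e1 = 1" "norm e2 = 1" "inner e1 e2 = 0" "cross3 e1 e2 = p"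
    "0 < lam" "lam \<le> 1" "lam\<^sup>2 \<le> \<mu>" "\<mu> \<le> 1" "0 \<le> \<alpha>" "\<alpha>\<^sup>2 \<le> (1 - \<mu>) * (\<mu> - lam\<^sup>2)"
    "N *v e1 = (lam * cos \<theta>) *\<^sub>R e1 - (lam * sin \<theta>) *\<^sub>R e2"
    "N *v e2 = (lam * sin \<theta>) *\<^sub>R e1 + (lam * cos \<theta>) *\<^sub>R e2"
    "N *v p = \<alpha> *\<^sub>R e1 + \<mu> *\<^sub>R p" "d = - \<alpha> *\<^sub>R e1 + (1 - \<mu>) *\<^sub>R p"
proof -
  obtain \<mu> l where mu: "\<forall>x. inner p (N *v x) = \<mu> * inner p x"
    and cr: "\<forall>x. inner p x = 0 \<longrightarrow> N *v (cross3 p x) = cross3 p (N *v x)"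
    and nr: "\<forall>x. inner p x = 0 \<longrightarrow> (norm (N *v x))\<^sup>2 = l * (norm x)\<^sup>2"
    and l: "0 \<le> l" "l \<le> \<mu>" "\<mu> \<le> 1" "(norm d)\<^sup>2 \<le> (1 - \<mu>) * (1 - l)"
    by (rule pure_to_pure_conformal[OF CP p p fix_p])
  have pp: "inner p p = 1" using p by (simp add: norm_eq_1)
  define v where "v = N *v p - \<mu> *\<^sub>R p"
  have pv: "inner p v = 0"
    using mu pp by (simp add: v_def inner_diff_right)
  obtain e1 \<alpha> where e1: "norm e1 = 1" "inner p e1 = 0" "v = \<alpha> *\<^sub>R e1" "0 \<le> \<alpha>"
  proof (cases "v = 0")
    case True
    obtain e where "norm e = 1" "inner p e = 0"
      using exists_orthogonal_unit by blast
    then show thesis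
      using that[of e 0] True by simp
  next
    case False
    then show thesis
      using that[of "v /\<^sub>R norm v" "norm v"] pv by simp
  qed
  define e2 where "e2 = cross3 p e1"
  note e2 = frame_of_two[OF p e1(1,2), folded e2_def]
  note frame = e1(1) e2
  note fp = frame_props[OF frame]
  have Np: "N *v p = \<alpha> *\<^sub>R e1 + \<mu> *\<^sub>R p"
    using e1(3) by (simp add: v_def algebra_simps)
  have d: "d = - \<alpha> *\<^sub>R e1 + (1 - \<mu>) *\<^sub>R p"
    using fix_p Np by (simp add: algebra_simps)
  define a where "a = inner e1 (N *v e1)"
  define b where "b = inner e2 (N *v e1)"
  have Ne1: "N *v e1 = a *\<^sub>R e1 + b *\<^sub>R e2"
    using frame_expand[OF frame, of "N *v e1"] mu e1(2) by (simp add: a_def b_def)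
  have "N *v e2 = cross3 p (N *v e1)"
    using cr e1(2) by (simp add: e2_def)
  also have "\<dots> = a *\<^sub>R e2 - b *\<^sub>R e1"
    unfolding Ne1 by (simp add: cross_add_right cross_mult_right fp)
  finally have Ne2: "N *v e2 = a *\<^sub>R e2 - b *\<^sub>R e1" .
  have lab: "l = a\<^sup>2 + b\<^sup>2"
    using nr[rule_format, OF e1(2)] e1(1) frame_norm[OF frame, of "N *v e1"] mu e1(2) by (simp add: a_def b_def)
  have "l \<noteq> 0"
  proof
    assume "l = 0"
    then have "\<forall>x. inner p x = 0 \<longrightarrow> N *v x = 0"
      using nr by simp
    then show False using nz by blast
  qed
  with l have l0: "0 < l" by simp
  define lam where "lam = sqrt l"
  have lam: "0 < lam" "lam\<^sup>2 = l" "lam \<le> 1"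
    using l0 l by (simp_all add: lam_def)
  have "a\<^sup>2 + (- b)\<^sup>2 = lam\<^sup>2"
    by (simp add: lam lab)
  \<comment> \<open>The planar block of the first form turns \<open>e1\<close> towards
    \<open>- e2\<close>, hence the sign of \<open>b\<close>.\<close>
  then obtain \<theta> where \<theta>: "a = lam * cos \<theta>" "- b = lam * sin \<theta>"
    using polar_pair lam(1) by (metis less_irrefl)
  have "inner e1 d = - \<alpha>" "inner e2 d = 0" "inner p d = 1 - \<mu>"
    unfolding d using frame fp pp e1(2) by (simp_all add: inner_diff_right norm_eq_1 inner_commute[of e2 e1])
  then have "(norm d)\<^sup>2 = \<alpha>\<^sup>2 + (1 - \<mu>)\<^sup>2"
    using frame_norm[OF frame, of d] by simp
  with l(4) have \<alpha>: "\<alpha>\<^sup>2 \<le> (1 - \<mu>) * (\<mu> - l)"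
    by (simp add: power2_eq_square algebra_simps)
  have b: "b = - (lam * sin \<theta>)" using \<theta> by simp
  show thesis
    by (rule that[OF frame lam(1) lam(3) _ l(3) e1(4) _ _ _ Np d, of \<theta>])
      (use l \<alpha> in \<open>simp_all add: lam Ne1 Ne2 \<theta>(1) b algebra_simps\<close>)
qed

text \<open>The map reverses \<open>p - q\<close>, so \<open>\<mu> = 1\<close> and the bound on the
  shift makes it zero. If \<open>q\<close> were not antipodal to \<open>p\<close>, the normalised
  bisector of the pair would be a fixed pure state. With \<open>q = - p\<close> the planar block
  anticommutes with the quarter turn and is a scaled reflection.\<close>

lemma swapped_pure_normal_form:
  assumes CP: "completely_positive (bmap N d)" and p: "norm p = 1" "norm q = 1" "p \<noteq> q"
    and swap: "N *v p + d = q" "N *v q + d = p"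
    and no_fix: "\<And>x. norm x = 1 \<Longrightarrow> N *v x + d \<noteq> x"
  shows "d = 0" "q = - p" "N *v p = - p"
    "\<not> (\<forall>x. inner p x = 0 \<longrightarrow> N *v x = 0) \<Longrightarrow> \<exists>e1 e2 \<theta> lam. norm e1 = 1 \<and> norm e2 = 1 \<and> inner e1 e2 = 0 \<and> cross3 e1 e2 = p
       \<and> 0 < lam \<and> lam \<le> 1 \<and> N *v e1 = (lam * cos \<theta>) *\<^sub>R e1 + (lam * sin \<theta>) *\<^sub>R e2
       \<and> N *v e2 = (lam * sin \<theta>) *\<^sub>R e1 - (lam * cos \<theta>) *\<^sub>R e2"
proof -
  obtain \<mu> l where mu: "\<forall>x. inner q (N *v x) = \<mu> * inner p x"
    and cr: "\<forall>x. inner p x = 0 \<longrightarrow> N *v (cross3 p x) = cross3 q (N *v x)"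
    and nr: "\<forall>x. inner p x = 0 \<longrightarrow> (norm (N *v x))\<^sup>2 = l * (norm x)\<^sup>2"
    and l: "0 \<le> l" "l \<le> \<mu>" "\<mu> \<le> 1" "(norm d)\<^sup>2 \<le> (1 - \<mu>) * (1 - l)"
    by (rule pure_to_pure_conformal[OF CP p(1,2) swap(1)])
  have u: "inner p p = 1" "inner q q = 1" using p by (simp_all add: norm_eq_1)
  have pq: "inner p q \<noteq> 1"
    using inner_neq_1_if_unit_neq p by blast
  have "N *v (p - q) = (N *v p + d) - (N *v q + d)"
    by (simp add: matrix_vector_mult_diff_distrib)
  also have "\<dots> = q - p"
    by (simp only: swap)
  finally have "N *v (p - q) = q - p" .
  then have "\<mu> * (1 - inner p q) = 1 - inner p q"
    using mu[rule_format, of "p - q"] u by (simp add: inner_diff_right inner_commute)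
  then have \<mu>: "\<mu> = 1" using pq by simp
  then show d: "d = 0" using l(4) by simp
  have Np: "N *v p = q" "N *v q = p" using swap d by simp_all
  show q: "q = - p"
  proof (rule ccontr)
    assume "q \<noteq> - p"
    then have s: "p + q \<noteq> 0"
      by (metis add_eq_0_iff)
    have "N *v ((p + q) /\<^sub>R norm (p + q)) = (p + q) /\<^sub>R norm (p + q)"
      by (simp add: matrix_vector_mult_scaleR matrix_vector_right_distrib Np add.commute)
    then show False
      using no_fix[of "(p + q) /\<^sub>R norm (p + q)"] d s by simp
  qed
  show "N *v p = - p" using Np q by simp
  assume nz: "\<not> (\<forall>x. inner p x = 0 \<longrightarrow> N *v x = 0)"
  obtain e1 where e1: "norm e1 = 1" "inner p e1 = 0"
    using exists_orthogonal_unit by blast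
  define e2 where "e2 = cross3 p e1"
  note e2 = frame_of_two[OF p(1) e1, folded e2_def]
  note frame = e1(1) e2
  note fp = frame_props[OF frame]
  define a where "a = inner e1 (N *v e1)"
  define b where "b = inner e2 (N *v e1)"
  have pN: "inner p (N *v e1) = 0"
    using mu[rule_format, of e1] e1(2) q by simp
  have Ne1: "N *v e1 = a *\<^sub>R e1 + b *\<^sub>R e2"
    using frame_expand[OF frame, of "N *v e1"] pN by (simp add: a_def b_def)
  have "N *v e2 = cross3 q (N *v e1)"
    using cr e1(2) by (simp add: e2_def)
  also have "\<dots> = b *\<^sub>R e1 - a *\<^sub>R e2"
    unfolding Ne1 q by (simp add: cross_add_right cross_mult_right cross_minus_left fp)
  finally have Ne2: "N *v e2 = b *\<^sub>R e1 - a *\<^sub>R e2" .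
  have lab: "l = a\<^sup>2 + b\<^sup>2"
    using nr[rule_format, OF e1(2)] e1(1) frame_norm[OF frame, of "N *v e1"] pN by (simp add: a_def b_def)
  have "l \<noteq> 0"
  proof
    assume "l = 0"
    then have "\<forall>x. inner p x = 0 \<longrightarrow> N *v x = 0"
      using nr by simp
    then show False using nz by blast
  qed
  with l have l0: "0 < l" by simp
  define lam where "lam = sqrt l"
  have lam: "0 < lam" "lam\<^sup>2 = l" "lam \<le> 1"
    using l0 l by (simp_all add: lam_def)
  obtain \<theta> where \<theta>: "a = lam * cos \<theta>" "b = lam * sin \<theta>"
    using polar_pair[of a b lam] lam lab by (metis less_irrefl)
  show "\<exists>e1 e2 \<theta> lam. norm e1 = 1 \<and> norm e2 = 1 \<and> inner e1 e2 = 0 \<and> cross3 e1 e2 = p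
       \<and> 0 < lam \<and> lam \<le> 1 \<and> N *v e1 = (lam * cos \<theta>) *\<^sub>R e1 + (lam * sin \<theta>) *\<^sub>R e2
       \<and> N *v e2 = (lam * sin \<theta>) *\<^sub>R e1 - (lam * cos \<theta>) *\<^sub>R e2"
    using frame lam Ne1 Ne2 \<theta> by blast
qed

subsection \<open>Channels with entanglement-breaking powers\<close>

text \<open>If only the component along \<open>p\<close> survives, the map measures along
  \<open>p\<close> and prepares the images of the two poles.\<close>

lemma rank_one_entanglement_breaking:
  assumes p: "norm p = 1" and N: "\<forall>x. inner p x = 0 \<longrightarrow> N *v x = 0"
    and ball: "norm (N *v p + d) \<le> 1" "norm (N *v (- p) + d) \<le> 1"
  shows "entanglement_breaking (bmap N d)"
proof -
  have Nx: "N *v x = inner p x *\<^sub>R (N *v p)" for x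
  proof -
    have "inner p (x - inner p x *\<^sub>R p) = 0"
      using p by (simp add: inner_diff_right norm_eq_1)
    then have "N *v (x - inner p x *\<^sub>R p) = 0"
      using N by blast
    then show ?thesis
      by (simp add: matrix_vector_mult_diff_distrib matrix_vector_mult_scaleR)
  qed
  have entry: "N $ i $ j = p $ j * (N *v p) $ i" for i j
    using arg_cong[OF Nx[of "axis j 1"], of "\<lambda>v. v $ i"]
    by (simp add: matrix_vector_mul_component inner_axis)
  define u where "u k = (if k = 0 then p else - p)" for k :: nat
  define s where "s k = (if k = 0 then N *v p + d else N *v (- p) + d)" for k :: nat
  show ?thesis
  proof (rule measure_prepare_entanglement_breaking[where m = 2 and w = "\<lambda>_. 1/2" and u = u and s = s])
    show "norm (u k) = 1" "norm (s k) \<le> 1" for k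
      using p ball by (simp_all add: u_def s_def)
    show "(\<Sum>k<2. (1/2) *\<^sub>R u k) = 0"
      by (simp add: sum_less_2 u_def)
    show "d = (\<Sum>k<2. (1/2) *\<^sub>R s k)"
      by (simp add: sum_less_2 s_def Finite_Cartesian_Product.vec_eq_iff field_simps)
    show "N $ i $ j = (\<Sum>k<2. 1/2 * s k $ i * u k $ j)" for i j
      unfolding entry[of i j] by (simp add: sum_less_2 s_def u_def field_simps)
  qed simp_all
qed

lemma sum_less_6: "(\<Sum>k<6. f k) = f 0 + f (Suc 0) + f 2 + f 3 + f 4 + (f 5 :: 'a::comm_monoid_add)"
  by (simp add: eval_nat_numeral)

text \<open>Measure the six effects \<open>(1 \<plusminus> \<sigma>\<^sub>j) / 6\<close> and prepare the states with Bloch vectors \<open>d \<plusminus> 3 N e\<^sub>j\<close>.\<close>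
lemma small_entanglement_breaking:
  assumes "\<And>j. norm (d + 3 *\<^sub>R (N *v axis j 1)) \<le> 1" "\<And>j. norm (d - 3 *\<^sub>R (N *v axis j 1)) \<le> 1"
  shows "entanglement_breaking (bmap N d)"
proof (rule measure_prepare_entanglement_breaking[where m = 6 and w = "\<lambda>_. 1/6"
    and u = "\<lambda>k. [axis 1 1, axis 2 1, axis 3 1, - axis 1 1, - axis 2 1, - axis 3 1] ! k"
    and s = "\<lambda>k. [d + 3 *\<^sub>R (N *v axis 1 1), d + 3 *\<^sub>R (N *v axis 2 1), d + 3 *\<^sub>R (N *v axis 3 1),
      d - 3 *\<^sub>R (N *v axis 1 1), d - 3 *\<^sub>R (N *v axis 2 1), d - 3 *\<^sub>R (N *v axis 3 1)] ! k"])
  fix k :: nat assume "k < 6"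
  then consider "k = 0" | "k = 1" | "k = 2" | "k = 3" | "k = 4" | "k = 5" by linarith
  then show "norm ([axis 1 1, axis 2 1, axis 3 1, - axis 1 1, - axis 2 1, - axis 3 1] ! k :: real^3) = 1"
    "norm ([d + 3 *\<^sub>R (N *v axis 1 1), d + 3 *\<^sub>R (N *v axis 2 1), d + 3 *\<^sub>R (N *v axis 3 1),
      d - 3 *\<^sub>R (N *v axis 1 1), d - 3 *\<^sub>R (N *v axis 2 1), d - 3 *\<^sub>R (N *v axis 3 1)] ! k) \<le> 1"
    by (cases; simp add: assms)+
next
  have "(N *v axis l 1) $ i = N $ i $ l" for i l
    by (simp add: matrix_vector_mul_component inner_axis)
  then show "N $ i $ j = (\<Sum>k<6. 1 / 6 * ([d + 3 *\<^sub>R (N *v axis 1 1), d + 3 *\<^sub>R (N *v axis 2 1), d + 3 *\<^sub>R (N *v axis 3 1),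
      d - 3 *\<^sub>R (N *v axis 1 1), d - 3 *\<^sub>R (N *v axis 2 1), d - 3 *\<^sub>R (N *v axis 3 1)] ! k) $ i *
      ([axis 1 1, axis 2 1, axis 3 1, - axis 1 1, - axis 2 1, - axis 3 1] ! k) $ j)" for i j
    using exhaust_3[of j] by (auto simp: sum_less_6 axis_def field_simps)
qed (simp_all add: sum_less_6 Finite_Cartesian_Product.vec_eq_iff field_simps)

text \<open>The linear part of a power shrinks geometrically, while its shift is the image of the
  centre under an iterate and keeps distance \<open>1 - t\<close> from the sphere. A sufficiently
  high power therefore fits the six-outcome measurement.\<close>

lemma contraction_power_entanglement_breaking:
  assumes t: "\<And>x. norm x \<le> 1 \<Longrightarrow> norm (N *v x + d) \<le> t" "t < 1"
  obtains k where "1 \<le> k" "entanglement_breaking (bmap N d ^^ k)"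
proof -
  have t0: "0 \<le> t"
  proof -
    have "norm d \<le> t"
      using t(1)[of 0] by simp
    then show ?thesis
      using norm_ge_zero[of d] by (rule order_trans[rotated])
  qed
  have half: "norm (N *v x) \<le> t" if "norm x \<le> 1" for x
  proof -
    have "(norm (d + N *v x))\<^sup>2 \<le> t\<^sup>2" "(norm (d - N *v x))\<^sup>2 \<le> t\<^sup>2"
      using t(1)[of x] t(1)[of "- x"] that by (simp_all add: add.commute power_mono)
    moreover have "(norm (d + N *v x))\<^sup>2 + (norm (d - N *v x))\<^sup>2 = 2 * (norm d)\<^sup>2 + 2 * (norm (N *v x))\<^sup>2"
      by (simp add: power2_norm_eq_inner inner_add_left inner_add_right inner_diff_left inner_diff_right)
    ultimately have "(norm (N *v x))\<^sup>2 \<le> t\<^sup>2"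
      using zero_le_power2[of "norm d"] by linarith
    then show ?thesis
      using t0 power2_le_imp_le by blast
  qed
  have contr: "norm (N *v x) \<le> t * norm x" for x
  proof (cases "x = 0")
    case False
    then have "norm (N *v (x /\<^sub>R norm x)) \<le> t"
      by (intro half) simp
    then show ?thesis
      using False by (simp add: matrix_vector_mult_scaleR divide_inverse[symmetric] field_simps)
  qed simp
  \<comment> \<open>The room \<open>1 - t\<close> between the shift and the sphere, divided by the
    factor 3 in the states prepared by \<open>small_entanglement_breaking\<close>.\<close>
  obtain n where n: "t ^ n < (1 - t) / 3"
    using real_arch_pow_inv[of "(1 - t) / 3" t] t(2) by auto
  obtain M c where M: "bmap N d ^^ Suc n = bmap M c" "\<forall>x. M *v x + c = ((\<lambda>x. N *v x + d) ^^ Suc n) x"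
    "\<forall>x. M *v x = (((*v) N) ^^ Suc n) x"
    by (rule bmap_funpow[of "Suc n" N d]) simp
  have "norm ((((*v) N) ^^ k) x) \<le> t ^ k * norm x" for k x
  proof (induction k)
    case (Suc k)
    have "norm ((((*v) N) ^^ Suc k) x) \<le> t * norm ((((*v) N) ^^ k) x)"
      using contr by simp
    also have "\<dots> \<le> t * (t ^ k * norm x)"
      using Suc t0 by (intro mult_left_mono)
    finally show ?case by simp
  qed simp
  from this[of "Suc n"] have Mx: "norm (M *v x) \<le> t ^ Suc n * norm x" for x
    unfolding M(3)[rule_format] .
  have iter: "norm (((\<lambda>x. N *v x + d) ^^ k) 0) \<le> 1" for k
    using t by (induction k) (auto intro: order_trans[OF t(1)])
  have "norm c = norm (((\<lambda>x. N *v x + d) ^^ Suc n) 0)"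
    using M(2)[rule_format, of 0] by simp
  also have "\<dots> \<le> t"
    using t(1)[OF iter[of n]] by simp
  finally have c: "norm c \<le> t" .
  have "norm (3 *\<^sub>R (M *v axis j 1)) \<le> 1 - t" for j
  proof -
    have "norm (M *v axis j 1) \<le> t ^ Suc n"
      using Mx[of "axis j 1"] by simp
    also have "\<dots> \<le> t ^ n"
      using t t0 by (intro power_decreasing) auto
    finally show ?thesis using n by simp
  qed
  then have "entanglement_breaking (bmap M c)"
    using c norm_triangle_le[of c] norm_triangle_le_diff[of c]
    by (intro small_entanglement_breaking) (smt (verit))+
  then show thesis
    using that[of "Suc n"] M(1) by simp
qed

subsection \<open>Entanglement-saving channels\<close>

lemma entanglement_saving_if_pure_orbit:
  assumes inj: "\<forall>x. N *v x = 0 \<longrightarrow> x = 0" and p: "norm p = 1"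
    and orbit: "\<forall>k. norm (((\<lambda>x. N *v x + d) ^^ k) p) = 1"
  shows "entanglement_saving (bmap N d)"
  unfolding entanglement_saving_def
proof (intro allI impI notI)
  fix k :: nat assume k: "1 \<le> k" and EB: "entanglement_breaking (bmap N d ^^ k)"
  obtain M c where M: "bmap N d ^^ k = bmap M c" "\<forall>x. M *v x + c = ((\<lambda>x. N *v x + d) ^^ k) x"
    "\<forall>x. M *v x = (((*v) N) ^^ k) x"
    by (rule bmap_funpow[OF k])
  obtain e where e: "norm e = 1" "inner p e = 0"
    using exists_orthogonal_unit by blast
  have "norm (M *v p + c) = 1"
    using orbit M(2) by simp
  then have "M *v e = 0"
    using entanglement_breaking_rank_one[OF EB[unfolded M(1)] p _ refl e(2)] by blast
  then have "(((*v) N) ^^ k) e = 0"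
    using M(3) by simp
  moreover have "(((*v) N) ^^ k) x = 0 \<Longrightarrow> x = 0" for x
    using inj by (induction k) auto
  ultimately have "e = 0"
    by blast
  then show False
    using e(1) by simp
qed

lemma entanglement_saving_pure_dynamics:
  assumes CP: "completely_positive (bmap N d)" and ES: "entanglement_saving (bmap N d)"
  shows "(\<exists>p. norm p = 1 \<and> N *v p + d = p) \<or>
    (\<exists>p q. norm p = 1 \<and> norm q = 1 \<and> p \<noteq> q \<and> N *v p + d = q \<and> N *v q + d = p)"
proof (rule ccontr)
  assume no: "\<not> ?thesis"
  define f where "f x = N *v x + d" for x
  have no_fix: "f p \<noteq> p" if "norm p = 1" for p
    using no that by (auto simp: f_def)
  have no_swap: "f (f p) \<noteq> p" if "norm p = 1" "norm (f p) = 1" for p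
    using no no_fix[OF that(1)] that unfolding f_def by metis
  have ball: "norm (f x) \<le> 1" if "norm x \<le> 1" for x
    using channel_ball[OF CP that] by (simp add: f_def)
  \<comment> \<open>Carries purity of the third image backwards along the orbit.\<close>
  have interior: "norm x = 1" if "norm x \<le> 1" "norm (f x) = 1" for x
    using channel_constant_if_interior_to_pure[OF CP, of x] that no_fix unfolding f_def by force
  obtain M c where M: "bmap N d ^^ 3 = bmap M c" "\<forall>x. M *v x + c = ((\<lambda>x. N *v x + d) ^^ 3) x"
    "\<forall>x. M *v x = (((*v) N) ^^ 3) x"
    by (rule bmap_funpow[of 3 N d]) simp
  have Mf: "M *v x + c = f (f (f x))" for x
    using M(2) by (simp add: f_def numeral_3_eq_3)
  have strict: "norm (M *v x + c) < 1" if x: "norm x = 1" for x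
  proof (rule ccontr)
    assume "\<not> norm (M *v x + c) < 1"
    then have 3: "norm (f (f (f x))) = 1"
      using ball[OF ball[OF ball, of x]] x unfolding Mf by simp
    have 2: "norm (f (f x)) = 1"
      using interior[OF _ 3] ball[OF ball, of x] x by simp
    have 1: "norm (f x) = 1"
      using interior[OF _ 2] ball[of x] x by simp
    obtain y where "norm y = 1" "N *v y + d = y"
      by (rule three_pure_outputs_fixed[OF CP x 1 2 3])
        (use no_fix[OF x] no_fix[OF 1] no_swap[OF x 1] in \<open>auto simp: f_def\<close>)
    then show False
      using no_fix by (auto simp: f_def)
  qed
  have "continuous_on (sphere 0 1) (\<lambda>x. norm (M *v x + c))"
    by (intro continuous_intros)
  moreover have "sphere (0::real^3) 1 \<noteq> {}"
    by simp
  ultimately obtain x0 where x0: "x0 \<in> sphere 0 1" "\<forall>x\<in>sphere 0 1. norm (M *v x + c) \<le> norm (M *v x0 + c)"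
    using continuous_attains_sup[of "sphere 0 1" "\<lambda>x. norm (M *v x + c)"] compact_sphere by blast
  define t where "t = norm (M *v x0 + c)"
  have t: "t < 1" "norm (M *v x + c) \<le> t" if "norm x \<le> 1" for x
  proof -
    show "t < 1" using strict x0(1) by (simp add: t_def)
    show "norm (M *v x + c) \<le> t"
      by (rule affine_ball_le[OF _ that]) (use x0(2) in \<open>simp add: t_def\<close>)
  qed
  obtain k where k: "1 \<le> k" "entanglement_breaking (bmap M c ^^ k)"
    using contraction_power_entanglement_breaking[of M c t] t[of 0] t(2) by (metis norm_zero zero_le_one)
  then have "entanglement_breaking (bmap N d ^^ (3 * k))"
    by (simp add: funpow_mult M(1)[symmetric] mult.commute)
  then show False
    using ES k(1) unfolding entanglement_saving_def by simp
qed

section \<open>The normal forms as matrices, and saving of entanglement by them\<close>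

definition frame_mat :: "real^3 \<Rightarrow> real^3 \<Rightarrow> real^3 \<Rightarrow> real^3^3" where
  "frame_mat e1 e2 e3 = (\<chi> i j. if j = 1 then e1 $ i else if j = 2 then e2 $ i else e3 $ i)"

lemma frame_mat_mult: "frame_mat e1 e2 e3 *v x = (x $ 1) *\<^sub>R e1 + (x $ 2) *\<^sub>R e2 + (x $ 3) *\<^sub>R e3"
  by (simp add: frame_mat_def matrix_vector_mult_def sum_3 Finite_Cartesian_Product.vec_eq_iff)

lemma frame_mat_rotation:
  assumes "norm e1 = 1" "norm e2 = 1" "inner e1 e2 = 0" "cross3 e1 e2 = e3"
  shows "transpose (frame_mat e1 e2 e3) ** frame_mat e1 e2 e3 = Finite_Cartesian_Product.mat 1"
    "frame_mat e1 e2 e3 ** transpose (frame_mat e1 e2 e3) = Finite_Cartesian_Product.mat 1"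
    "Determinants.det (frame_mat e1 e2 e3) = 1"
proof -
  note fp = frame_props[OF assms]
  have "inner e1 e1 = 1" "inner e2 e2 = 1" "inner e3 e3 = 1" "inner e1 e2 = 0" "inner e1 e3 = 0" "inner e2 e3 = 0"
    using assms fp by (simp_all add: norm_eq_1)
  then show 1: "transpose (frame_mat e1 e2 e3) ** frame_mat e1 e2 e3 = Finite_Cartesian_Product.mat 1"
    unfolding inner_vec_def sum_3
    by (simp add: Finite_Cartesian_Product.vec_eq_iff forall_3 Finite_Cartesian_Product.transpose_def matrix_matrix_mult_def sum_3
        frame_mat_def Finite_Cartesian_Product.mat_def mult.commute)
  then show "frame_mat e1 e2 e3 ** transpose (frame_mat e1 e2 e3) = Finite_Cartesian_Product.mat 1"
    by (simp add: matrix_left_right_inverse)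
  have "Determinants.det (frame_mat e1 e2 e3) = inner (cross3 e1 e2) e3"
    by (simp add: det_3 frame_mat_def cross3_def inner_vec_def sum_3 algebra_simps)
  then show "Determinants.det (frame_mat e1 e2 e3) = 1"
    using fp(1) assms(4) by (simp add: norm_eq_1)
qed

lemma matrix_conjugate_eqI:
  fixes N Q D :: "real^3^3"
  assumes "Q ** transpose Q = Finite_Cartesian_Product.mat 1" "\<And>x. N *v (Q *v x) = Q *v (D *v x)"
  shows "N = Q ** D ** transpose Q"
proof -
  have "N ** Q = Q ** D"
    using assms(2) by (simp add: matrix_eq matrix_vector_mul_assoc)
  then have "N ** (Q ** transpose Q) = Q ** D ** transpose Q"
    by (simp add: matrix_mul_assoc)
  then show ?thesis by (simp add: assms(1))
qed

definition fixed_form :: "real \<Rightarrow> real \<Rightarrow> real \<Rightarrow> real \<Rightarrow> real^3^3" where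
  "fixed_form \<theta> lam \<mu> \<alpha> = vector [vector [lam * cos \<theta>, lam * sin \<theta>, \<alpha>],
     vector [- lam * sin \<theta>, lam * cos \<theta>, 0], vector [0, 0, \<mu>]]"

definition swap_form :: "real \<Rightarrow> real \<Rightarrow> real^3^3" where
  "swap_form \<theta> lam = vector [vector [lam * cos \<theta>, lam * sin \<theta>, 0],
     vector [lam * sin \<theta>, - lam * cos \<theta>, 0], vector [0, 0, -1]]"

lemma fixed_form_mult:
  "fixed_form \<theta> lam \<mu> \<alpha> *v x = vector [lam * cos \<theta> * x$1 + lam * sin \<theta> * x$2 + \<alpha> * x$3,
     - lam * sin \<theta> * x$1 + lam * cos \<theta> * x$2, \<mu> * x$3]"
  by (simp add: fixed_form_def matrix_vector_mult_def sum_3 Finite_Cartesian_Product.vec_eq_iff forall_3)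

lemma swap_form_mult:
  "swap_form \<theta> lam *v x = vector [lam * cos \<theta> * x$1 + lam * sin \<theta> * x$2,
     lam * sin \<theta> * x$1 - lam * cos \<theta> * x$2, - x$3]"
  by (simp add: swap_form_def matrix_vector_mult_def sum_3 Finite_Cartesian_Product.vec_eq_iff forall_3)

text \<open>The coefficient matrix is a reflection, hence its own inverse. Flipping the sign of one
  equation brings the rotation block to this shape, so both normal forms are covered.\<close>

lemma rotation_system_zero:
  fixes c s u v :: real
  assumes "c\<^sup>2 + s\<^sup>2 = 1" "c * u + s * v = 0" "s * u - c * v = 0"
  shows "u = 0" "v = 0"
proof -
  have "1 * u = c * (c * u + s * v) + s * (s * u - c * v)" "1 * v = s * (c * u + s * v) - c * (s * u - c * v)"
    unfolding assms(1)[symmetric] by (simp_all add: power2_eq_square algebra_simps)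
  then show "u = 0" "v = 0"
    unfolding assms(2,3) by simp_all
qed

lemma fixed_form_inj:
  assumes "fixed_form \<theta> lam \<mu> \<alpha> *v x = 0" "lam \<noteq> 0" "\<mu> \<noteq> 0"
  shows "x = 0"
proof -
  have x3: "x$3 = 0"
    using assms by (auto simp: fixed_form_mult Finite_Cartesian_Product.vec_eq_iff forall_3)
  then have "lam * (cos \<theta> * x$1 + sin \<theta> * x$2) = 0" "lam * (sin \<theta> * x$1 - cos \<theta> * x$2) = 0"
    using assms(1) by (auto simp: fixed_form_mult Finite_Cartesian_Product.vec_eq_iff forall_3 algebra_simps)
  then have "cos \<theta> * x$1 + sin \<theta> * x$2 = 0" "sin \<theta> * x$1 - cos \<theta> * x$2 = 0"
    using assms(2) by simp_all
  note rotation_system_zero[OF sin_cos_squared_add2 this]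
  then show ?thesis
    using x3 by (simp add: Finite_Cartesian_Product.vec_eq_iff forall_3)
qed

lemma swap_form_inj:
  assumes "swap_form \<theta> lam *v x = 0" "lam \<noteq> 0"
  shows "x = 0"
proof -
  have x3: "x$3 = 0"
    using assms by (auto simp: swap_form_mult Finite_Cartesian_Product.vec_eq_iff forall_3)
  have "lam * (cos \<theta> * x$1 + sin \<theta> * x$2) = 0" "lam * (sin \<theta> * x$1 - cos \<theta> * x$2) = 0"
    using assms(1) by (auto simp: swap_form_mult Finite_Cartesian_Product.vec_eq_iff forall_3 algebra_simps)
  then have "cos \<theta> * x$1 + sin \<theta> * x$2 = 0" "sin \<theta> * x$1 - cos \<theta> * x$2 = 0"
    using assms(2) by simp_all
  note rotation_system_zero[OF sin_cos_squared_add2 this]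
  then show ?thesis
    using x3 by (simp add: Finite_Cartesian_Product.vec_eq_iff forall_3)
qed

text \<open>Common core for both normal forms: conjugation by \<open>Q\<close> carries the orbit of
  \<open>p\<close>, a fixed point or an antipodal pair, to an orbit on the sphere and preserves
  injectivity.\<close>

lemma conjugate_entanglement_saving:
  fixes Q D :: "real^3^3"
  assumes Q: "Q ** transpose Q = Finite_Cartesian_Product.mat 1"
    and inj: "\<And>x. D *v x = 0 \<Longrightarrow> x = 0"
    and p: "norm p = 1" and orbit: "D *v p + v = p \<or> D *v p + v = - p \<and> D *v (- p) + v = p"
  shows "entanglement_saving (bmap (Q ** D ** transpose Q) (Q *v v))"
proof -
  define T where "T = transpose Q"
  have QT: "Q ** T = Finite_Cartesian_Product.mat 1" "T ** Q = Finite_Cartesian_Product.mat 1"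
    using Q by (simp_all add: T_def matrix_left_right_inverse)
  have TQ: "T *v (Q *v x) = x" "Q *v (T *v x) = x" for x
    by (simp_all add: matrix_vector_mul_assoc QT)
  have nQ: "norm (Q *v x) = norm x" for x
  proof -
    have "inner (Q *v x) (Q *v x) = inner ((Q *v x) v* Q) x"
      by (simp only: dot_lmul_matrix)
    also have "(Q *v x) v* Q = T *v (Q *v x)"
      by (simp add: T_def)
    finally show ?thesis
      by (simp add: norm_eq_sqrt_inner TQ)
  qed
  have conj: "(Q ** D ** T) *v (Q *v x) + Q *v v = Q *v (D *v x + v)" for x
    by (simp add: matrix_vector_mul_assoc[symmetric] TQ matrix_vector_right_distrib)
  have "\<forall>k. norm (((\<lambda>x. (Q ** D ** T) *v x + Q *v v) ^^ k) (Q *v p)) = 1"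
  proof
    fix k
    define A where "A = (if D *v p + v = p then {p} else {p, - p})"
    have A: "D *v y + v \<in> A" if "y \<in> A" for y
      using that orbit by (auto simp: A_def split: if_splits)
    have "\<exists>y\<in>A. ((\<lambda>x. (Q ** D ** T) *v x + Q *v v) ^^ k) (Q *v p) = Q *v y"
    proof (induction k)
      case 0
      show ?case by (simp add: A_def)
    next
      case (Suc k)
      then obtain y where "y \<in> A" "((\<lambda>x. (Q ** D ** T) *v x + Q *v v) ^^ k) (Q *v p) = Q *v y"
        by blast
      then show ?case
        using A[of y] conj[of y] by (intro bexI[of _ "D *v y + v"]) simp_all
    qed
    then obtain y where "y \<in> A" "((\<lambda>x. (Q ** D ** T) *v x + Q *v v) ^^ k) (Q *v p) = Q *v y"
      by blast
    then show "norm (((\<lambda>x. (Q ** D ** T) *v x + Q *v v) ^^ k) (Q *v p)) = 1"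
      using p by (auto simp: nQ A_def split: if_splits)
  qed
  moreover have "\<forall>x. (Q ** D ** T) *v x = 0 \<longrightarrow> x = 0"
  proof (intro allI impI)
    fix x assume "(Q ** D ** T) *v x = 0"
    then have "Q *v (D *v (T *v x)) = 0"
      by (simp only: matrix_vector_mul_assoc[symmetric])
    then have "T *v x = 0"
      using inj nQ[of "D *v (T *v x)"] by simp
    then show "x = 0"
      using TQ(2)[of x] by simp
  qed
  ultimately show ?thesis
    unfolding T_def[symmetric]
    by (intro entanglement_saving_if_pure_orbit[where p = "Q *v p"]) (simp_all add: nQ p)
qed

lemma entanglement_saving_bmap_iff:
  assumes CP: "completely_positive (bmap N d)"
  shows "entanglement_saving (bmap N d) \<longleftrightarrow>
    (\<exists>Q \<theta> lam \<mu> \<alpha>. Q ** transpose Q = Finite_Cartesian_Product.mat 1 \<and> Determinants.det Q = 1 \<and>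
       0 < lam \<and> lam \<le> 1 \<and> lam\<^sup>2 \<le> \<mu> \<and> \<mu> \<le> 1 \<and> 0 \<le> \<alpha> \<and> \<alpha>\<^sup>2 \<le> (1 - \<mu>) * (\<mu> - lam\<^sup>2) \<and>
       N = Q ** fixed_form \<theta> lam \<mu> \<alpha> ** transpose Q \<and> d = Q *v vector [- \<alpha>, 0, 1 - \<mu>]) \<or>
    (d = 0 \<and> (\<exists>Q \<theta> lam. Q ** transpose Q = Finite_Cartesian_Product.mat 1 \<and> Determinants.det Q = 1 \<and>
       0 < lam \<and> lam \<le> 1 \<and> N = Q ** swap_form \<theta> lam ** transpose Q))" (is "?ES \<longleftrightarrow> ?F \<or> ?S")
proof
  assume ES: ?ES
  then have "\<not> entanglement_breaking (bmap N d ^^ 1)"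
    unfolding entanglement_saving_def by blast
  then have not_EB: "\<not> entanglement_breaking (bmap N d)"
    by simp
  \<comment> \<open>If \<open>N\<close> killed the plane orthogonal to some unit \<open>p\<close>,
    the channel itself would already be entanglement-breaking. This makes \<open>lam\<close>
    positive in both forms.\<close>
  have nz: "\<not> (\<forall>x. inner p x = 0 \<longrightarrow> N *v x = 0)" if "norm p = 1" for p
    using rank_one_entanglement_breaking[of p N d] channel_ball[OF CP, of p] channel_ball[OF CP, of "- p"] not_EB that
    by auto
  show "?F \<or> ?S"
  \<comment> \<open>Fixed states come first, so that the swapped case may assume there are none;
    this is what forces the swapped pair to be antipodal.\<close>
  proof (cases "\<exists>p. norm p = 1 \<and> N *v p + d = p")
    case True
    then obtain p where p: "norm p = 1" "N *v p + d = p" by blast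
    obtain e1 e2 \<theta> lam \<mu> \<alpha> where frame: "norm e1 = 1" "norm e2 = 1" "inner e1 e2 = 0" "cross3 e1 e2 = p"
      and par: "0 < lam" "lam \<le> 1" "lam\<^sup>2 \<le> \<mu>" "\<mu> \<le> 1" "0 \<le> \<alpha>" "\<alpha>\<^sup>2 \<le> (1 - \<mu>) * (\<mu> - lam\<^sup>2)"
      and N: "N *v e1 = (lam * cos \<theta>) *\<^sub>R e1 - (lam * sin \<theta>) *\<^sub>R e2"
      "N *v e2 = (lam * sin \<theta>) *\<^sub>R e1 + (lam * cos \<theta>) *\<^sub>R e2"
      "N *v p = \<alpha> *\<^sub>R e1 + \<mu> *\<^sub>R p" and d: "d = - \<alpha> *\<^sub>R e1 + (1 - \<mu>) *\<^sub>R p"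
      by (rule pure_fixed_normal_form[OF CP p nz[OF p(1)]])
    note R = frame_mat_rotation[OF frame]
    have "N = frame_mat e1 e2 p ** fixed_form \<theta> lam \<mu> \<alpha> ** transpose (frame_mat e1 e2 p)"
      by (rule matrix_conjugate_eqI[OF R(2)])
        (simp add: frame_mat_mult fixed_form_mult matrix_vector_right_distrib matrix_vector_mult_scaleR N algebra_simps)
    moreover have "d = frame_mat e1 e2 p *v vector [- \<alpha>, 0, 1 - \<mu>]"
      by (simp add: frame_mat_mult d)
    ultimately have ?F
      using R(2,3) par by blast
    then show ?thesis ..
  next
    case False
    then obtain p q where p: "norm p = 1" "norm q = 1" "p \<noteq> q" "N *v p + d = q" "N *v q + d = p"
      using entanglement_saving_pure_dynamics[OF CP ES] by blast
    have no_fix: "\<And>x. norm x = 1 \<Longrightarrow> N *v x + d \<noteq> x"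
      using False by blast
    note S = swapped_pure_normal_form[OF CP p no_fix]
    obtain e1 e2 \<theta> lam where frame: "norm e1 = 1" "norm e2 = 1" "inner e1 e2 = 0" "cross3 e1 e2 = p"
      and lam: "0 < lam" "lam \<le> 1"
      and N: "N *v e1 = (lam * cos \<theta>) *\<^sub>R e1 + (lam * sin \<theta>) *\<^sub>R e2"
      "N *v e2 = (lam * sin \<theta>) *\<^sub>R e1 - (lam * cos \<theta>) *\<^sub>R e2"
      using S(4)[OF _ nz[OF p(1)]] by blast
    note R = frame_mat_rotation[OF frame]
    have "N = frame_mat e1 e2 p ** swap_form \<theta> lam ** transpose (frame_mat e1 e2 p)"
      by (rule matrix_conjugate_eqI[OF R(2)])
        (simp add: frame_mat_mult swap_form_mult matrix_vector_right_distrib matrix_vector_mult_scaleR N S(3) algebra_simps)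
    then have ?S
      using S(1) R(2,3) lam by blast
    then show ?thesis ..
  qed
next
  have a: "norm (axis 3 1 :: real^3) = 1" by simp
  assume "?F \<or> ?S"
  then show ?ES
  proof
    assume ?F
    then obtain Q \<theta> lam \<mu> \<alpha> where Q: "Q ** transpose Q = Finite_Cartesian_Product.mat 1"
      and par: "0 < lam" "lam\<^sup>2 \<le> \<mu>"
      and N: "N = Q ** fixed_form \<theta> lam \<mu> \<alpha> ** transpose Q" and d: "d = Q *v vector [- \<alpha>, 0, 1 - \<mu>]"
      by blast
    have "0 < \<mu>"
      using par zero_less_power[of lam 2] by linarith
    moreover have "fixed_form \<theta> lam \<mu> \<alpha> *v axis 3 1 + vector [- \<alpha>, 0, 1 - \<mu>] = axis 3 1"
      by (simp add: fixed_form_mult axis_def Finite_Cartesian_Product.vec_eq_iff forall_3)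
    ultimately show ?ES
      unfolding N d using par(1) by (intro conjugate_entanglement_saving[OF Q _ a]) (auto dest: fixed_form_inj)
  next
    assume ?S
    then obtain Q \<theta> lam where Q: "Q ** transpose Q = Finite_Cartesian_Product.mat 1" and lam: "0 < lam"
      and N: "N = Q ** swap_form \<theta> lam ** transpose Q" and d: "d = Q *v 0"
      by auto
    have "swap_form \<theta> lam *v axis 3 1 + 0 = - axis 3 1" "swap_form \<theta> lam *v (- axis 3 1) + 0 = axis 3 1"
      by (simp_all add: swap_form_mult axis_def Finite_Cartesian_Product.vec_eq_iff forall_3)
    then show ?ES
      unfolding N d using lam by (intro conjugate_entanglement_saving[OF Q _ a]) (auto dest: swap_form_inj)
  qed
qed

section \<open>Translation to the matrices of the statement\<close>

lemma mat3_fixed_form: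
  "mat3 (mat_of_rows_list 3 [[lam * cos \<theta>, lam * sin \<theta>, \<alpha>], [- lam * sin \<theta>, lam * cos \<theta>, 0], [0, 0, \<mu>]]) =
    fixed_form \<theta> lam \<mu> \<alpha>"
  by (simp add: mat3_def fixed_form_def mat_of_rows_list_def Finite_Cartesian_Product.vec_eq_iff forall_3)

lemma mat3_swap_form:
  "mat3 (mat_of_rows_list 3 [[lam * cos \<theta>, lam * sin \<theta>, 0], [lam * sin \<theta>, - lam * cos \<theta>, 0], [0, 0, -1]]) =
    swap_form \<theta> lam"
  by (simp add: mat3_def swap_form_def mat_of_rows_list_def Finite_Cartesian_Product.vec_eq_iff forall_3)

lemma mat_of_rows_list_carrier_3: "mat_of_rows_list 3 [r1, r2, r3] \<in> carrier_mat 3 3"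
  by (intro carrier_matI) (simp_all add: mat_of_rows_list_def)

lemma vec_of_list_3: "vec_of_list [x, y, z] \<in> carrier_vec 3" "vec3 (vec_of_list [x, y, z]) = vector [x, y, z]"
  by (auto intro!: carrier_vecI simp: vec3_def Finite_Cartesian_Product.vec_eq_iff forall_3 numeral_2_eq_2)

lemma SO3_conjugate_iff:
  assumes "M \<in> carrier_mat 3 3" "D \<in> carrier_mat 3 3" "Q \<in> SO3"
  shows "M = Q * D * transpose_mat Q \<longleftrightarrow> mat3 M = mat3 Q ** mat3 D ** transpose (mat3 Q)"
proof -
  have "Q \<in> carrier_mat 3 3"
    using assms(3) by (simp add: SO3_iff)
  then show ?thesis
    using assms by (subst mat3_eq_iff) (auto simp: mat3_mult mat3_transpose matrix_mul_assoc)
qed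

lemma SO3_apply_iff:
  assumes "c \<in> carrier_vec 3" "v \<in> carrier_vec 3" "Q \<in> SO3"
  shows "c = Q *\<^sub>v v \<longleftrightarrow> vec3 c = mat3 Q *v vec3 v"
proof -
  have "Q \<in> carrier_mat 3 3"
    using assms(3) by (simp add: SO3_iff)
  then show ?thesis
    using assms by (subst vec3_eq_iff) (auto simp: mat3_mult_vec)
qed

lemma ex_SO3_iff:
  "(\<exists>Q\<in>SO3. P (mat3 Q)) \<longleftrightarrow> (\<exists>Q. Q ** transpose Q = Finite_Cartesian_Product.mat 1 \<and> Determinants.det Q = 1 \<and> P Q)"
proof
  assume "\<exists>Q\<in>SO3. P (mat3 Q)"
  then show "\<exists>Q. Q ** transpose Q = Finite_Cartesian_Product.mat 1 \<and> Determinants.det Q = 1 \<and> P Q"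
    using SO3_iff by blast
next
  assume "\<exists>Q. Q ** transpose Q = Finite_Cartesian_Product.mat 1 \<and> Determinants.det Q = 1 \<and> P Q"
  then obtain Q where "Q ** transpose Q = Finite_Cartesian_Product.mat 1" "Determinants.det Q = 1" "P Q"
    by blast
  then show "\<exists>Q\<in>SO3. P (mat3 Q)"
    by (intro bexI[of _ "of_mat3 Q"]) (simp_all add: SO3_iff)
qed

theorem mainTheorem12:
  fixes M :: "real mat" and c :: "real vec"
  assumes "qubit_channel M c"
  shows "entanglement_saving (bloch_map M c) \<longleftrightarrow>
    ((\<exists>Q \<theta> lam \<mu> \<alpha>. Q \<in> SO3 \<and> 0 < lam \<and> lam \<le> 1 \<and> lam\<^sup>2 \<le> \<mu> \<and> \<mu> \<le> 1 \<and> 0 \<le> \<alpha> \<and>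
        \<alpha>\<^sup>2 \<le> (1 - \<mu>) * (\<mu> - lam\<^sup>2) \<and>
        M = Q * mat_of_rows_list 3 [[lam * cos \<theta>, lam * sin \<theta>, \<alpha>],
                                    [- lam * sin \<theta>, lam * cos \<theta>, 0],
                                    [0, 0, \<mu>]] * transpose_mat Q \<and>
        c = Q *\<^sub>v vec_of_list [- \<alpha>, 0, 1 - \<mu>])
     \<or> (c = 0\<^sub>v 3 \<and>
        (\<exists>Q \<theta> lam. Q \<in> SO3 \<and> 0 < lam \<and> lam \<le> 1 \<and>
        M = Q * mat_of_rows_list 3 [[lam * cos \<theta>, lam * sin \<theta>, 0],
                                    [lam * sin \<theta>, - lam * cos \<theta>, 0],
                                    [0, 0, -1]] * transpose_mat Q)))"
proof -
  have M: "M \<in> carrier_mat 3 3" and c: "c \<in> carrier_vec 3" and "completely_positive (bloch_map M c)"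
    using assms by (auto simp: qubit_channel_def)
  then have CP: "completely_positive (bmap (mat3 M) (vec3 c))"
    by (simp add: bloch_map_eq_bmap)
  have c0: "c = 0\<^sub>v 3 \<longleftrightarrow> vec3 c = 0"
    using vec3_eq_iff[OF c, of "0\<^sub>v 3"] by simp
  note convert = SO3_conjugate_iff[OF M mat_of_rows_list_carrier_3] SO3_apply_iff[OF c vec_of_list_3(1)]
    mat3_fixed_form mat3_swap_form vec_of_list_3(2)
  \<comment> \<open>Both alternatives are arranged as predicates of the rotation alone, since
    \<open>Q\<close> is the only quantified variable whose type changes in the translation.\<close>
  define P where "P Q \<longleftrightarrow> (\<exists>\<theta> lam \<mu> \<alpha>. 0 < lam \<and> lam \<le> 1 \<and> lam\<^sup>2 \<le> \<mu> \<and> \<mu> \<le> 1 \<and> 0 \<le> \<alpha> \<and>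
    \<alpha>\<^sup>2 \<le> (1 - \<mu>) * (\<mu> - lam\<^sup>2) \<and> mat3 M = Q ** fixed_form \<theta> lam \<mu> \<alpha> ** transpose Q \<and>
    vec3 c = Q *v vector [- \<alpha>, 0, 1 - \<mu>])" for Q
  define R where "R Q \<longleftrightarrow> (\<exists>\<theta> lam. 0 < lam \<and> lam \<le> 1 \<and> mat3 M = Q ** swap_form \<theta> lam ** transpose Q)" for Q
  have "entanglement_saving (bloch_map M c) \<longleftrightarrow> (\<exists>Q\<in>SO3. P (mat3 Q)) \<or> (vec3 c = 0 \<and> (\<exists>Q\<in>SO3. R (mat3 Q)))"
    unfolding bloch_map_eq_bmap[OF M c] entanglement_saving_bmap_iff[OF CP] ex_SO3_iff[of P] ex_SO3_iff[of R]
    by (simp only: P_def R_def ex_simps)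
  then show ?thesis
    unfolding c0 P_def R_def by (simp only: Bex_def ex_simps convert cong: conj_cong)
qed

end
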